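(* Let $-1\leq\alpha<2$ and let $s<-2$. For every $\epsilon>0$ there exist a real-valued function $u_0\in C^\infty(\mathbb{T})$, a time $t\in(0,\epsilon)$, and the solution $u=u(x,t)$ (existing up to and including the time $t$) of the Cauchy problem \[ \partial_t u+|\partial_x|^\alpha\partial_x u+u\,\partial_x u=0,\qquad u(x,0)=u_0(x),\qquad x\in\mathbb{T}, \] such that \[ \|u_0\|_{\dot{H}^s(\mathbb{T})}<\epsilon\quad\text{but}\quad \|u(\cdot,t)\|_{\dot{H}^s(\mathbb{T})}>\epsilon^{-1}. \]
   Context: $\mathbb{T}=\mathbb{R}/2\pi\mathbb{Z}$. Functions $u=u(x,t)$ are real valued. $|\partial_x|=\sqrt{-\partial_x^2}$ is the Fourier multiplier with symbol $|k|$, $k\in\mathbb{Z}$, so $|\partial_x|^\alpha\partial_x$ is the Fourier multiplier with symbol $i|k|^\alpha k$ (equal to $0$ at $k=0$). $\dot{H}^s(\mathbb{T})$ is the homogeneous $L^2$-based Sobolev space of mean-zero periodic distributions, with norm $\|f\|_{\dot H^s(\mathbb{T})}^2=\sum_{k\neq0}|k|^{2s}|\widehat f(k)|^2$. The mean of a solution is conserved in time, so a solution with mean-zero initial datum remains of mean zero. For $u_0\in H^{r}(\mathbb{T})$ with $r>3/2$, "the solution" is the unique solution in $C((-t_*,t_* );H^{r}(\mathbb{T}))$ for some $t_*>0$, with $t_*$ the maximal time of existence (classical local well-posedness theory); higher Sobolev regularity of the initial datum persists on the interval of existence. *)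

theory Defs
  imports "HOL-Analysis.Analysis"
begin

text \<open>Functions on the torus $R/2\pi Z$ are $2\pi$-periodic functions on the real line.\<close>

definition periodic :: "(real \<Rightarrow> real) \<Rightarrow> bool" where
  "periodic f \<longleftrightarrow> (\<forall>x. f (x + 2 * pi) = f x)"

definition smooth_torus :: "(real \<Rightarrow> real) set" where
  "smooth_torus = {f. periodic f \<and> (\<forall>n x. (deriv ^^ n) f field_differentiable at x)}"

definition fourier_coeff :: "(real \<Rightarrow> real) \<Rightarrow> int \<Rightarrow> complex" where
  "fourier_coeff f k =
     integral {-pi..pi} (\<lambda>x. complex_of_real (f x) * cis (- (of_int k * x))) / of_real (2 * pi)"

text \<open>The operator with symbol \<open>m\<close>, given by its Fourier series. It is only applied to smooth
  functions and symbols of polynomial growth, for which the series converges absolutely.\<close>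

definition fourier_multiplier :: "(int \<Rightarrow> complex) \<Rightarrow> (real \<Rightarrow> real) \<Rightarrow> real \<Rightarrow> complex" where
  "fourier_multiplier m f x = (\<Sum>\<^sub>\<infinity>k. m k * fourier_coeff f k * cis (of_int k * x))"

text \<open>The symbol of $|\partial_x|^\alpha\partial_x$. It vanishes at \<open>k = 0\<close> also for
  \<open>\<alpha> \<le> 0\<close>, because \<open>0 powr \<alpha> = 0\<close>.\<close>

definition disp_symbol :: "real \<Rightarrow> int \<Rightarrow> complex" where
  "disp_symbol \<alpha> k = \<i> * of_real (\<bar>of_int k\<bar> powr \<alpha>) * of_int k"

definition sobolev :: "real \<Rightarrow> (real \<Rightarrow> real) set" where
  "sobolev r = {f. periodic f \<and> f absolutely_integrable_on {-pi..pi} \<and>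
     (\<lambda>k. (1 + (of_int k)\<^sup>2) powr r * (cmod (fourier_coeff f k))\<^sup>2) summable_on UNIV}"

definition sobolev_norm :: "real \<Rightarrow> (real \<Rightarrow> real) \<Rightarrow> real" where
  "sobolev_norm r f =
     sqrt (\<Sum>\<^sub>\<infinity>k. (1 + (of_int k)\<^sup>2) powr r * (cmod (fourier_coeff f k))\<^sup>2)"

text \<open>The integrable functions (rather than all distributions) in the homogeneous Sobolev space
  of mean-zero periodic distributions.\<close>

definition hom_sobolev :: "real \<Rightarrow> (real \<Rightarrow> real) set" where
  "hom_sobolev s = {f. periodic f \<and> f absolutely_integrable_on {-pi..pi} \<and> fourier_coeff f 0 = 0 \<and>
     (\<lambda>k. \<bar>of_int k\<bar> powr (2 * s) * (cmod (fourier_coeff f k))\<^sup>2) summable_on (UNIV - {0})}"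

definition hom_sobolev_norm :: "real \<Rightarrow> (real \<Rightarrow> real) \<Rightarrow> real" where
  "hom_sobolev_norm s f =
     sqrt (\<Sum>\<^sub>\<infinity>k\<in>UNIV - {0}. \<bar>of_int k\<bar> powr (2 * s) * (cmod (fourier_coeff f k))\<^sup>2)"

text \<open>In \<open>u t x\<close> the first argument is time and the second is space.\<close>

definition continuous_in_sobolev :: "real \<Rightarrow> real set \<Rightarrow> (real \<Rightarrow> real \<Rightarrow> real) \<Rightarrow> bool" where
  "continuous_in_sobolev r I u \<longleftrightarrow> (\<forall>t\<in>I. u t \<in> sobolev r \<and>
     ((\<lambda>\<tau>. sobolev_norm r (\<lambda>x. u \<tau> x - u t x)) \<longlongrightarrow> 0) (at t within I))"

text \<open>The solution on \<open>(-T, T)\<close> with smooth initial datum \<open>u\<^sub>0\<close>. By persistence of regularity it lies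
  in $C((-T,T);H^r)$ for every \<open>r > 3/2\<close>, so that \<open>u t\<close> is (the continuous representative of) a
  smooth function and the equation holds pointwise. The equation is written in the complex numbers
  because the value of a Fourier multiplier is complex.\<close>

definition solution_on :: "real \<Rightarrow> (real \<Rightarrow> real) \<Rightarrow> real \<Rightarrow> (real \<Rightarrow> real \<Rightarrow> real) \<Rightarrow> bool" where
  "solution_on \<alpha> u\<^sub>0 T u \<longleftrightarrow>
     0 < T \<and> u 0 = u\<^sub>0 \<and>
     (\<forall>r>3/2. continuous_in_sobolev r {-T<..<T} u) \<and>
     (\<forall>t\<in>{-T<..<T}. u t \<in> smooth_torus) \<and>
     (\<forall>t\<in>{-T<..<T}. \<forall>x. (\<lambda>\<tau>. u \<tau> x) differentiable at t \<and>
        complex_of_real (deriv (\<lambda>\<tau>. u \<tau> x) t)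
          + fourier_multiplier (disp_symbol \<alpha>) (u t) x
          + complex_of_real (u t x * deriv (u t) x) = 0)"

end

(* The solution is built from its expansion in powers of the initial datum. On the Fourier side the
   part of degree n + 1 is obtained from the lower ones by Duhamel's formula; it is a trigonometric
   polynomial of degree at most (n + 1) M, so the derivative in the nonlinearity costs a factor
   proportional to n + 1, which the time integration gains back. With A the sum of the absolute values
   of the Fourier coefficients of the datum, the series therefore converges geometrically, with all
   derivatives, for |t| <= 1 / (8 M A); dispersion plays no role because its propagator is unimodular
   on each Fourier mode.
   For norm inflation take four modes +-M and +-(M - 1), each of size M^2. The norm of the datum in H^s
   is of order M^(s + 2), while the quadratic interaction of M and -(M - 1) feeds the mode 1, which at a
   time of order 1 / M^3 has size of order M; the parts of higher degree at mode 1 are smaller by a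
   small constant factor. *)
theory Submission
  imports Defs
begin

section \<open>Primitives, term-by-term differentiation and Sobolev norms\<close>

text \<open>The nonlinearity loses a derivative, which obstructs a contraction argument in a fixed
  Sobolev space; grading by degree confines the loss at each step to a known band of frequencies. In
  the sum of the absolute Fourier coefficients products cost nothing, and the estimates then obey
  the recursion of the Catalan numbers, whence the 4 in the radius 1 / (4 M A). This bound alone is
  too weak for the inflation: it compares every term with A, of order M^2, while the growth to be
  seen at the mode 1 is of order M. The missing factor comes from the outer derivative of the
  nonlinearity, which at the output mode 1 costs 1 and not M. The exponents fit together as follows:
  with amplitude M^2, smallness of M A t allows t of order 1 / M^3; on that scale phases of size at
  most M^3 do not oscillate; and the quadratic interaction produces (M^2)^2 t, of order M. The
  datum, of order M^(s + 2), tends to 0 exactly when s < -2.\<close>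

text \<open>The oriented integral covers negative \<open>t\<close> too, as the two-sided time
  interval in \<open>solution_on\<close> requires.\<close>

definition primitive :: "(real \<Rightarrow> complex) \<Rightarrow> real \<Rightarrow> complex" where
  "primitive f t = (LBINT y=ereal 0..ereal t. f y)"

lemma primitive_has_vector_derivative:
  assumes "continuous_on UNIV f"
  shows "(primitive f has_vector_derivative f t) (at t)"
proof -
  define b where "b = \<bar>t\<bar> + 1"
  have "((\<lambda>u. LBINT y=ereal 0..ereal u. f y) has_vector_derivative f t) (at t within {-b..b})"
    by (rule interval_integral_FTC2) (auto simp: b_def intro: continuous_on_subset[OF assms])
  moreover have "at t within {-b..b} = at t"
    by (rule at_within_interior) (auto simp: b_def)
  ultimately show ?thesis
    unfolding primitive_def[abs_def] by simp
qed

lemma primitive_0 [simp]: "primitive f 0 = 0"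
  by (simp add: primitive_def interval_integral_endpoints_same)

lemma primitive_cnj: "primitive (\<lambda>y. cnj (f y)) t = cnj (primitive f t)"
proof -
  have "(\<lambda>y. indicator S y *\<^sub>R cnj (f y)) = (\<lambda>y. cnj (indicator S y *\<^sub>R f y))" for S :: "real set"
    by (auto simp: scaleR_conv_of_real)
  then show ?thesis
    unfolding primitive_def interval_lebesgue_integral_def set_lebesgue_integral_def
    by (simp only: Bochner_Integration.integral_cnj complex_cnj_minus if_distrib[of cnj])
qed

text \<open>Mean value inequality against the comparison function
  \<open>K * x ^ Suc n / real (Suc n)\<close>; negative times follow by reflection. The divisor
  \<open>Suc n\<close> is what later absorbs the derivative in the nonlinearity.\<close>

lemma norm_le_of_vector_derivative_le_power:
  fixes G :: "real \<Rightarrow> 'a::real_normed_vector"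
  assumes G: "\<And>\<tau>. (G has_vector_derivative g \<tau>) (at \<tau>)"
    and "G 0 = 0" and g: "\<And>\<tau>. norm (g \<tau>) \<le> K * \<bar>\<tau>\<bar> ^ n"
  shows "norm (G t) \<le> K * \<bar>t\<bar> ^ Suc n / real (Suc n)"
proof -
  have pos: "norm (H s) \<le> K * s ^ Suc n / real (Suc n)"
    if H: "\<And>\<tau>. (H has_vector_derivative h \<tau>) (at \<tau>)" and "H 0 = 0"
      and h: "\<And>\<tau>. norm (h \<tau>) \<le> K * \<bar>\<tau>\<bar> ^ n" and "s > 0"
    for H h :: "real \<Rightarrow> 'a" and s :: real
  proof -
    have "norm (H s - H 0) \<le> K * s ^ Suc n / real (Suc n) - K * 0 ^ Suc n / real (Suc n)"
    proof (rule differentiable_bound_general[where f' = h and \<phi>' = "\<lambda>x. K * x ^ n"])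
      show "continuous_on {0..s} H"
        using H by (meson continuous_at_imp_continuous_on has_vector_derivative_continuous)
      show "continuous_on {0..s} (\<lambda>x. K * x ^ Suc n / real (Suc n))"
        by (intro continuous_intros) auto
      show "((\<lambda>x. K * x ^ Suc n / real (Suc n)) has_vector_derivative K * x ^ n) (at x)" for x
        by (rule has_real_derivative_iff_has_vector_derivative[THEN iffD1])
          (auto intro!: derivative_eq_intros simp del: of_nat_Suc power_Suc)
      show "norm (h x) \<le> K * x ^ n" if "0 < x" for x
        using h[of x] that by simp
    qed (use that in auto)
    then show ?thesis using that by simp
  qed
  consider "t = 0" | "t > 0" | "t < 0" by linarith
  then show ?thesis
  proof cases
    case 2
    then show ?thesis using pos[OF G assms(2) g, of t] by simp
  next
    case 3
    have "norm ((\<lambda>x. G (- x)) (- t)) \<le> K * (- t) ^ Suc n / real (Suc n)"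
    proof (rule pos)
      show "((\<lambda>x. G (- x)) has_vector_derivative - g (- \<tau>)) (at \<tau>)" for \<tau>
      proof -
        have "(uminus has_vector_derivative (- 1 :: real)) (at \<tau>)"
          by (auto simp flip: has_real_derivative_iff_has_vector_derivative
              intro!: derivative_eq_intros)
        then show ?thesis
          using vector_diff_chain_at[of uminus "-1" \<tau> G "g (- \<tau>)"] G[of "- \<tau>"]
          by (simp add: o_def)
      qed
    qed (use 3 assms(2) g[of "- _"] in auto)
    then show ?thesis using 3 by simp
  qed (use assms(2) in simp)
qed

text \<open>Only the sum of the derivatives is controlled, so applying the preceding estimate to
  each mode separately would lose a factor for the number of modes.\<close>

lemma sum_norm_le_of_vector_derivative_le_power:
  fixes G :: "'i \<Rightarrow> real \<Rightarrow> complex"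
  assumes G: "\<And>k \<tau>. k \<in> S \<Longrightarrow> (G k has_vector_derivative g k \<tau>) (at \<tau>)"
    and G0: "\<And>k. k \<in> S \<Longrightarrow> G k 0 = 0"
    and g: "\<And>\<tau>. (\<Sum>k\<in>S. norm (g k \<tau>)) \<le> K * \<bar>\<tau>\<bar> ^ n"
  shows "(\<Sum>k\<in>S. norm (G k t)) \<le> K * \<bar>t\<bar> ^ Suc n / real (Suc n)"
proof -
  \<comment> \<open>Rotating each component by a constant phase turns the sum of norms into the norm of a sum.\<close>
  define \<theta> where "\<theta> k = cnj (sgn (G k t))" for k
  have norm_\<theta>: "norm (\<theta> k) \<le> 1" for k
    by (simp add: \<theta>_def norm_sgn)
  have "norm (\<Sum>k\<in>S. \<theta> k * G k t) \<le> K * \<bar>t\<bar> ^ Suc n / real (Suc n)"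
  proof (rule norm_le_of_vector_derivative_le_power[where g = "\<lambda>\<tau>. \<Sum>k\<in>S. \<theta> k * g k \<tau>"])
    show "((\<lambda>\<tau>. \<Sum>k\<in>S. \<theta> k * G k \<tau>) has_vector_derivative (\<Sum>k\<in>S. \<theta> k * g k \<tau>)) (at \<tau>)" for \<tau>
      by (intro has_vector_derivative_sum has_vector_derivative_mult_right G)
    have "norm (\<Sum>k\<in>S. \<theta> k * g k \<tau>) \<le> (\<Sum>k\<in>S. norm (g k \<tau>))" for \<tau>
      by (intro sum_norm_le) (simp add: norm_mult mult_left_le_one_le norm_\<theta>)
    then show "norm (\<Sum>k\<in>S. \<theta> k * g k \<tau>) \<le> K * \<bar>\<tau>\<bar> ^ n" for \<tau>
      using g order_trans by blast
  qed (simp add: G0)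
  moreover have "\<theta> k * G k t = of_real (norm (G k t))" for k
    by (cases "G k t = 0") (auto simp: \<theta>_def sgn_eq complex_norm_square[symmetric] power2_eq_square mult.commute)
  ultimately show ?thesis
    by (simp flip: of_real_sum add: abs_of_nonneg sum_nonneg)
qed

section \<open>Exponentials and term-by-term differentiation\<close>

lemma has_vector_derivative_cis:
  "((\<lambda>t. cis (b * t)) has_vector_derivative \<i> * b * cis (b * t)) (at t)"
proof -
  have cis: "cis (b * t) = exp (t *\<^sub>R (\<i> * b))" for t
    by (simp add: cis_conv_exp scaleR_conv_of_real mult_ac)
  show ?thesis
    unfolding cis mult.commute[of "\<i> * b"] by (rule exp_scaleR_has_vector_derivative_right)
qed

lemma summable_power_mult_geometric:
  "summable (\<lambda>n. real (Suc n) ^ q * (1 / 2) ^ n)"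
proof (rule summable_comparison_test')
  \<comment> \<open>\<open>d\<close> is so small that \<open>exp (d * q) \<le> 3 / 2\<close>; then
    the polynomial factor grows no faster than a multiple of \<open>(3 / 2) ^ n\<close>, and 3/2
    times 1/2 is the ratio 3/4. \<open>Suc q\<close> in the denominator covers
    \<open>q = 0\<close>.\<close>
  define d where "d = ln (3 / 2) / real (Suc q)"
  have d: "0 < d" by (simp add: d_def)
  have exp_d: "exp (d * real q) \<le> 3 / 2"
  proof -
    have "d * real q \<le> ln (3 / 2)"
      by (simp add: d_def divide_simps mult_left_mono)
    then show ?thesis by (metis exp_le_cancel_iff exp_ln zero_less_divide_iff zero_less_numeral)
  qed
  show "summable (\<lambda>n. (1 / d) ^ q * exp (d * real q) * (3 / 4) ^ n)"
    by (intro summable_mult summable_geometric) simp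
  show "norm (real (Suc n) ^ q * (1 / 2) ^ n) \<le> (1 / d) ^ q * exp (d * real q) * (3 / 4) ^ n"
    if "0 \<le> n" for n
  proof -
    have "d * real (Suc n) \<le> exp (d * real (Suc n))"
      using exp_ge_add_one_self[of "d * real (Suc n)"] by linarith
    then have "real (Suc n) \<le> (1 / d) * exp (d * real (Suc n))"
      using d by (simp add: field_simps)
    then have "real (Suc n) ^ q \<le> ((1 / d) * exp (d * real (Suc n))) ^ q"
      by (intro power_mono) auto
    also have "\<dots> = (1 / d) ^ q * exp (d * real q) ^ Suc n"
      unfolding power_mult_distrib by (simp only: exp_of_nat_mult[symmetric] mult_ac)
    also have "\<dots> = (1 / d) ^ q * exp (d * real q) * exp (d * real q) ^ n"
      by simp
    also have "\<dots> \<le> (1 / d) ^ q * exp (d * real q) * (3 / 2) ^ n"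
      using d exp_d by (intro mult_left_mono power_mono) auto
    finally have "real (Suc n) ^ q * (1 / 2) ^ n \<le> (1 / d) ^ q * exp (d * real q) * (3 / 2) ^ n * (1 / 2) ^ n"
      by (intro mult_right_mono) auto
    also have "\<dots> = (1 / d) ^ q * exp (d * real q) * (3 / 4) ^ n"
      by (simp add: mult.assoc flip: power_mult_distrib)
    finally show ?thesis by simp
  qed
qed

text \<open>Weierstrass' test makes the series of derivatives converge uniformly; multiplication by
  \<open>h\<close> turns this into the estimate uniform in the direction that
  \<open>has_derivative_series\<close> asks for. It is applied in space and in time.\<close>

lemma has_vector_derivative_suminf:
  fixes f :: "nat \<Rightarrow> real \<Rightarrow> 'a::banach"
  assumes S: "convex S" "open S"
    and f': "\<And>n x. x \<in> S \<Longrightarrow> (f n has_vector_derivative f' n x) (at x)"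
    and b: "\<And>n x. x \<in> S \<Longrightarrow> norm (f' n x) \<le> b n" "summable b"
    and f: "\<And>x. x \<in> S \<Longrightarrow> summable (\<lambda>n. f n x)"
    and x: "x \<in> S"
  shows "((\<lambda>x. \<Sum>n. f n x) has_vector_derivative (\<Sum>n. f' n x)) (at x)"
proof -
  have lim: "uniform_limit S (\<lambda>n x. \<Sum>i<n. f' i x) (\<lambda>x. \<Sum>i. f' i x) sequentially"
    by (rule Weierstrass_m_test[OF b])
  have "\<exists>g. \<forall>x\<in>S. (\<lambda>n. f n x) sums (g x) \<and>
      (g has_derivative (\<lambda>h. h *\<^sub>R (\<Sum>n. f' n x))) (at x within S)"
  proof (rule has_derivative_series[OF S(1) _ _ x])
    show "(f n has_derivative (\<lambda>h. h *\<^sub>R f' n x)) (at x within S)" if "x \<in> S" for n x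
      using f'[OF that, of n] unfolding has_vector_derivative_def by (rule has_derivative_at_withinI)
    show "(\<lambda>n. f n x) sums (\<Sum>n. f n x)" using f[OF x] by (rule summable_sums)
    show "\<forall>\<^sub>F n in sequentially. \<forall>x\<in>S. \<forall>h. norm ((\<Sum>i<n. h *\<^sub>R f' i x) - h *\<^sub>R (\<Sum>n. f' n x)) \<le> e * norm h"
      if "e > 0" for e
    proof -
      have "\<forall>\<^sub>F n in sequentially. \<forall>x\<in>S. dist (\<Sum>i<n. f' i x) (\<Sum>i. f' i x) < e"
        using lim that by (simp add: uniform_limit_iff)
      then show ?thesis
      proof eventually_elim
        case (elim n)
        show ?case
        proof (intro ballI allI)
          fix x h assume "x \<in> S"
          have "norm ((\<Sum>i<n. h *\<^sub>R f' i x) - h *\<^sub>R (\<Sum>n. f' n x))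
              = \<bar>h\<bar> * dist (\<Sum>i<n. f' i x) (\<Sum>i. f' i x)"
            by (simp add: dist_norm flip: scaleR_sum_right scaleR_diff_right)
          also have "\<dots> \<le> \<bar>h\<bar> * e" using elim \<open>x \<in> S\<close> by (intro mult_left_mono) auto
          finally show "norm ((\<Sum>i<n. h *\<^sub>R f' i x) - h *\<^sub>R (\<Sum>n. f' n x)) \<le> e * norm h"
            by (simp add: mult.commute)
        qed
      qed
    qed
  qed
  then obtain g where g: "\<And>x. x \<in> S \<Longrightarrow> (\<lambda>n. f n x) sums (g x)"
    "\<And>x. x \<in> S \<Longrightarrow> (g has_derivative (\<lambda>h. h *\<^sub>R (\<Sum>n. f' n x))) (at x within S)"
    by blast
  have "(g has_vector_derivative (\<Sum>n. f' n x)) (at x)"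
    using g(2)[OF x] at_within_open[OF x S(2)] by (simp add: has_vector_derivative_def)
  then show ?thesis
  proof (rule has_vector_derivative_transform_within_open[OF _ S(2) x])
    show "g y = (\<Sum>n. f n y)" if "y \<in> S" for y using g(1)[OF that] by (rule sums_unique)
  qed
qed

section \<open>Orthogonality of exponentials and Sobolev sums\<close>

lemma integral_cis:
  "integral {-pi..pi} (\<lambda>x. cis (of_int k * x)) = (if k = 0 then 2 * pi else 0)"
proof (cases "k = 0")
  case False
  have "((\<lambda>x. cis (of_int k * x)) has_integral
      cis (of_int k * pi) / (\<i> * of_int k) - cis (of_int k * (- pi)) / (\<i> * of_int k)) {-pi..pi}"
  proof (rule fundamental_theorem_of_calculus)
    fix x
    have "((\<lambda>x. cis (of_int k * x) / (\<i> * of_int k)) has_vector_derivative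
        \<i> * of_real (of_int k) * cis (of_int k * x) / (\<i> * of_int k)) (at x within {-pi..pi})"
      by (intro has_vector_derivative_divide has_vector_derivative_cis[THEN has_vector_derivative_at_within])
    then show "((\<lambda>x. cis (of_int k * x) / (\<i> * of_int k)) has_vector_derivative
        cis (of_int k * x)) (at x within {-pi..pi})"
      using False by simp
  qed simp
  moreover have "cis (of_int k * pi) = cis (of_int k * (- pi))"
    by (simp add: complex_eq_iff sin_times_pi_eq_0)
  ultimately show ?thesis using False by (simp add: integral_unique)
qed (simp add: scaleR_conv_of_real)

lemma summable_on_inverse_one_plus_square:
  "(\<lambda>k::int. inverse (1 + (of_int k)\<^sup>2) :: real) summable_on UNIV"
proof -
  have nat: "(\<lambda>n::nat. inverse (1 + (real n)\<^sup>2)) summable_on UNIV"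
  proof (rule norm_summable_imp_summable_on, rule summable_comparison_test')
    show "summable (\<lambda>n. 2 * inverse ((real (Suc n))\<^sup>2))"
      using inverse_power_summable[of 2, where 'a = real]
      by (intro summable_mult, subst summable_Suc_iff) simp
    have "(real (Suc n))\<^sup>2 \<le> 2 * (1 + (real n)\<^sup>2)" for n
      using sum_squares_bound[of "real n" 1] by (simp add: power2_eq_square algebra_simps)
    then show "norm (norm (inverse (1 + (real n)\<^sup>2))) \<le> 2 * inverse ((real (Suc n))\<^sup>2)" if "0 \<le> n" for n
      using sum_power2_gt_zero_iff[of 1 "real n"] by (simp add: divide_simps del: of_nat_Suc)
  qed
  have "(\<lambda>k::int. inverse (1 + (of_int k)\<^sup>2) :: real) summable_on (range int)"
    "(\<lambda>k::int. inverse (1 + (of_int k)\<^sup>2) :: real) summable_on (range (\<lambda>n. - int n))"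
    using nat by (auto simp: summable_on_reindex inj_on_def o_def)
  then have "(\<lambda>k::int. inverse (1 + (of_int k)\<^sup>2) :: real) summable_on (range int \<union> range (\<lambda>n. - int n))"
    by (rule summable_on_union)
  moreover have "range int \<union> range (\<lambda>n. - int n) = UNIV"
  proof -
    have "k \<in> range int \<union> range (\<lambda>n. - int n)" for k
      by (cases k rule: int_cases2) auto
    then show ?thesis by blast
  qed
  ultimately show ?thesis by simp
qed

text \<open>A family of summable bounds stable under the operations below: a weight
  \<open>\<bar>k\<bar>\<close> on \<open>band n\<close>, or a sum over \<open>band n\<close>, costs
  a multiple of \<open>Suc n\<close>, which only changes \<open>C\<close> and raises
  \<open>q\<close> by one.\<close>

definition geometric_bound :: "real \<Rightarrow> nat \<Rightarrow> nat \<Rightarrow> real" where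
  "geometric_bound C q n = C * (real (Suc n) ^ q * (1 / 2) ^ n)"

lemma summable_geometric_bound: "summable (geometric_bound C q)"
  unfolding geometric_bound_def[abs_def] by (intro summable_mult summable_power_mult_geometric)

lemma infsum_finite_support:
  assumes "finite S" "\<And>k. k \<notin> S \<Longrightarrow> f k = 0"
  shows "infsum f UNIV = sum f S"
proof -
  have "infsum f UNIV = infsum f S"
    by (rule infsum_cong_neutral) (use assms in auto)
  then show ?thesis using assms by simp
qed

text \<open>As \<open>r \<le> q \<le> 2 * q - 1\<close>, squaring a decay of order \<open>q\<close>
  pays for the weight and leaves a factor \<open>inverse w\<close>, which is summable over
  \<open>k\<close> for \<open>w = 1 + k ^ 2\<close>.\<close>

lemma powr_mult_square_le:
  fixes w y B r :: real
  assumes "1 \<le> w" "0 \<le> y" "w ^ q * y \<le> B" "r \<le> real q" "1 \<le> q"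
  shows "w powr r * y\<^sup>2 \<le> B\<^sup>2 * inverse w"
proof -
  have "w powr r \<le> w powr real (2 * q - 1)"
    using assms by (intro powr_mono) auto
  also have "\<dots> = w ^ (2 * q - 1)"
    using assms by (intro powr_realpow) simp
  also have "\<dots> = w ^ (2 * q) * inverse w"
    using assms power_minus_mult[of "2 * q" w] by (simp add: field_simps)
  also have "\<dots> = (w ^ q)\<^sup>2 * inverse w"
    by (simp add: power_mult mult.commute)
  finally have "w powr r * y\<^sup>2 \<le> (w ^ q)\<^sup>2 * inverse w * y\<^sup>2"
    by (rule mult_right_mono) simp
  also have "\<dots> = (w ^ q * y)\<^sup>2 * inverse w"
    by (simp add: power_mult_distrib)
  also have "\<dots> \<le> B\<^sup>2 * inverse w"
    using assms by (intro mult_right_mono power_mono) auto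
  finally show ?thesis .
qed

context
  fixes f :: "real \<Rightarrow> real" and q :: nat and r B :: real
  assumes decay: "\<And>k. (1 + (of_int k)\<^sup>2) ^ q * cmod (fourier_coeff f k) \<le> B"
    and q: "r \<le> real q" "1 \<le> q"
begin

lemma sobolev_term_le:
  "(1 + (of_int k)\<^sup>2) powr r * (cmod (fourier_coeff f k))\<^sup>2 \<le> B\<^sup>2 * inverse (1 + (of_int k)\<^sup>2)"
  by (rule powr_mult_square_le[OF _ _ decay q]) simp_all

lemma sobolev_summable:
  "(\<lambda>k. (1 + (of_int k)\<^sup>2) powr r * (cmod (fourier_coeff f k))\<^sup>2) summable_on UNIV"
  by (rule summable_on_comparison_test[OF _ sobolev_term_le])
    (simp_all add: summable_on_cmult_right summable_on_inverse_one_plus_square)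

text \<open>The bound is linear in \<open>B\<close>: for the difference of the solution at two
  times, with \<open>B\<close> proportional to their distance, it yields continuity in time.\<close>

lemma sobolev_norm_le:
  "sobolev_norm r f \<le> B * sqrt (\<Sum>\<^sub>\<infinity>k::int. inverse (1 + (of_int k)\<^sup>2))"
proof -
  have "0 \<le> B" by (rule order_trans[OF _ decay[of 0]]) simp
  have "(\<Sum>\<^sub>\<infinity>k. (1 + (of_int k)\<^sup>2) powr r * (cmod (fourier_coeff f k))\<^sup>2)
      \<le> (\<Sum>\<^sub>\<infinity>k::int. B\<^sup>2 * inverse (1 + (of_int k)\<^sup>2))"
    by (intro infsum_mono sobolev_summable sobolev_term_le summable_on_cmult_right
        summable_on_inverse_one_plus_square)
  then have "sobolev_norm r f \<le> sqrt (B\<^sup>2 * (\<Sum>\<^sub>\<infinity>k::int. inverse (1 + (of_int k)\<^sup>2)))"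
    unfolding sobolev_norm_def by (simp add: infsum_cmult_right')
  then show ?thesis using \<open>0 \<le> B\<close> by (simp add: real_sqrt_mult)
qed

end

lemma weighted_suminf_le:
  fixes g :: "nat \<Rightarrow> 'a::banach"
  assumes "1 \<le> w" "\<And>n. w * norm (g n) \<le> b n" "summable b"
  shows "summable (\<lambda>n. norm (g n))" "w * norm (\<Sum>n. g n) \<le> (\<Sum>n. b n)"
proof -
  have le: "norm (g n) \<le> b n" for n
    using assms(2)[of n] mult_right_mono[OF assms(1) norm_ge_zero[of "g n"]] by simp
  then show s: "summable (\<lambda>n. norm (g n))"
    by (intro summable_comparison_test'[OF assms(3), of 0]) simp
  have "w * norm (\<Sum>n. g n) \<le> w * (\<Sum>n. norm (g n))"
    using assms(1) by (intro mult_left_mono summable_norm s) simp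
  also have "\<dots> = (\<Sum>n. w * norm (g n))"
    using s by (rule suminf_mult[symmetric])
  also have "\<dots> \<le> (\<Sum>n. b n)"
    using s by (intro suminf_le assms summable_mult)
  finally show "w * norm (\<Sum>n. g n) \<le> (\<Sum>n. b n)" .
qed

lemma norm_diff_le_of_vector_derivative:
  fixes f :: "real \<Rightarrow> 'a::real_normed_vector"
  assumes "convex S" "open S" "x \<in> S" "y \<in> S"
    and f': "\<And>z. z \<in> S \<Longrightarrow> (f has_vector_derivative f' z) (at z)"
    and B: "\<And>z. z \<in> S \<Longrightarrow> norm (f' z) \<le> B"
  shows "norm (f x - f y) \<le> B * \<bar>x - y\<bar>"
proof -
  have "norm (f x - f y) \<le> B * norm (x - y)"
  proof (rule differentiable_bound[OF assms(1)])
    fix z assume z: "z \<in> S"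
    show "(f has_derivative (\<lambda>h. h *\<^sub>R f' z)) (at z within S)"
      using f'[OF z] unfolding has_vector_derivative_def by (rule has_derivative_at_withinI)
    show "onorm (\<lambda>h. h *\<^sub>R f' z) \<le> B"
      using mult_left_mono[OF B[OF z] abs_ge_zero] by (intro onorm_le) (simp add: mult.commute)
  qed (use assms in auto)
  then show ?thesis by simp
qed

section \<open>Detecting growth at the mode 1\<close>

text \<open>The weight of the mode 1 is 1 for every \<open>s\<close>, so growth there is visible
  however negative \<open>s\<close> is.\<close>

lemma norm_fourier_coeff_1_le:
  assumes "f \<in> hom_sobolev s"
  shows "norm (fourier_coeff f 1) \<le> hom_sobolev_norm s f"
proof -
  have "(\<Sum>k\<in>{1::int}. \<bar>of_int k\<bar> powr (2 * s) * (cmod (fourier_coeff f k))\<^sup>2)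
      \<le> (\<Sum>\<^sub>\<infinity>k\<in>UNIV - {0}. \<bar>of_int k\<bar> powr (2 * s) * (cmod (fourier_coeff f k))\<^sup>2)"
    using assms by (intro finite_sum_le_infsum) (auto simp: hom_sobolev_def)
  then show ?thesis
    unfolding hom_sobolev_norm_def by (intro real_le_rsqrt) simp
qed

lemma norm_cis_minus_1_le: "norm (cis (b * t) - 1) \<le> \<bar>b\<bar> * \<bar>t\<bar>"
proof -
  have "norm (cis (b * t) - 1) \<le> \<bar>b\<bar> * \<bar>t\<bar> ^ Suc 0 / real (Suc 0)"
  proof (rule norm_le_of_vector_derivative_le_power)
    show "((\<lambda>t. cis (b * t) - 1) has_vector_derivative \<i> * b * cis (b * \<tau>)) (at \<tau>)" for \<tau>
      using has_vector_derivative_diff[OF has_vector_derivative_cis has_vector_derivative_const] by simp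
  qed (simp_all add: norm_mult)
  then show ?thesis by simp
qed

text \<open>Replacing the exponential by 1 changes the integrand by at most
  \<open>C * \<bar>b\<bar> * \<bar>\<tau>\<bar>\<close>, hence the integral by at most
  \<open>C * \<bar>b\<bar> * t ^ 2 / 2\<close>, which is at most half of the main term
  \<open>C * t\<close>.\<close>

lemma norm_primitive_cis_ge:
  assumes "0 \<le> C" "0 \<le> t" "\<bar>b\<bar> * t \<le> 1"
  shows "C * t / 2 \<le> norm (primitive (\<lambda>\<tau>. of_real C * cis (b * \<tau>)) t)"
proof -
  define P where "P = primitive (\<lambda>\<tau>. of_real C * cis (b * \<tau>))"
  have "norm (P t - t *\<^sub>R of_real C) \<le> C * \<bar>b\<bar> * \<bar>t\<bar> ^ Suc 1 / real (Suc 1)"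
  proof (rule norm_le_of_vector_derivative_le_power)
    fix \<tau>
    have "(P has_vector_derivative of_real C * cis (b * \<tau>)) (at \<tau>)"
      unfolding P_def by (rule primitive_has_vector_derivative) (intro continuous_intros)
    moreover have "((\<lambda>\<tau>. \<tau> *\<^sub>R complex_of_real C) has_vector_derivative of_real C) (at \<tau>)"
      using has_vector_derivative_scaleR[OF DERIV_ident has_vector_derivative_const] by simp
    ultimately show "((\<lambda>\<tau>. P \<tau> - \<tau> *\<^sub>R of_real C) has_vector_derivative
        of_real C * (cis (b * \<tau>) - 1)) (at \<tau>)"
      unfolding right_diff_distrib mult_1_right by (rule has_vector_derivative_diff)
    show "norm (of_real C * (cis (b * \<tau>) - 1)) \<le> C * \<bar>b\<bar> * \<bar>\<tau>\<bar> ^ 1"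
      using mult_left_mono[OF norm_cis_minus_1_le assms(1), of b \<tau>] assms(1)
      by (simp add: norm_mult mult_ac)
  qed (simp add: P_def)
  also have "\<dots> = (C * t / 2) * (\<bar>b\<bar> * t)"
    using assms(2) by simp
  also have "\<dots> \<le> (C * t / 2) * 1"
    using assms by (intro mult_left_mono) auto
  finally have "norm (P t - t *\<^sub>R of_real C) \<le> C * t / 2" by simp
  moreover have "norm (t *\<^sub>R complex_of_real C) = C * t"
    using assms by simp
  ultimately show ?thesis
    using norm_triangle_ineq2[of "t *\<^sub>R complex_of_real C" "P t"]
    unfolding P_def[symmetric] norm_minus_commute[of "t *\<^sub>R complex_of_real C"] by linarith
qed

section \<open>The expansion in powers of the initial datum\<close>

text \<open>The dispersion relation stays abstract: its oddness and \<open>a_cnj\<close> make the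
  solution real, its cubic bound makes the dispersive term cost only a power of the degree, and
  \<open>a_nonzero\<close> makes the time \<open>T\<close> positive.\<close>

locale fourier_hierarchy =
  fixes \<omega> :: "int \<Rightarrow> real" and a :: "int \<Rightarrow> complex" and M :: nat
  assumes M_pos: "0 < M"
    and a_support: "\<And>k. int M < \<bar>k\<bar> \<Longrightarrow> a k = 0"
    and a_cnj: "\<And>k. a (- k) = cnj (a k)"
    and a_0: "a 0 = 0"
    and a_nonzero: "\<exists>k. a k \<noteq> 0"
    and \<omega>_odd: "\<And>k. \<omega> (- k) = - \<omega> k"
    and \<omega>_le: "\<And>k. \<bar>\<omega> k\<bar> \<le> \<bar>of_int k\<bar> ^ 3"
begin

text \<open>Index \<open>n\<close> stands for the part of degree \<open>n + 1\<close>, whose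
  frequencies are sums of \<open>n + 1\<close> frequencies of the datum; hence
  \<open>Suc n\<close>.\<close>

definition band :: "nat \<Rightarrow> int set" where
  "band n = {- int (Suc n * M)..int (Suc n * M)}"

text \<open>Duhamel's formula, with the nonlinearity written as half the derivative of the square,
  whence the factor \<open>k / 2\<close>. The factors of index \<open>m\<close> and
  \<open>n - m\<close> have degrees adding up to \<open>n + 2\<close>, the degree of index
  \<open>Suc n\<close>. Summing \<open>j\<close> over \<open>band m\<close> keeps the convolution
  finite and omits only zero terms, by \<open>coeff_support\<close>.\<close>

fun coeff :: "nat \<Rightarrow> int \<Rightarrow> real \<Rightarrow> complex" where
  "coeff 0 k t = cis (- \<omega> k * t) * a k"
| "coeff (Suc n) k t = - (\<i> * of_int k / 2) * (cis (- \<omega> k * t) *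
     primitive (\<lambda>\<tau>. cis (\<omega> k * \<tau>) * (\<Sum>m\<le>n. \<Sum>j\<in>band m. coeff m j \<tau> * coeff (n - m) (k - j) \<tau>)) t)"

declare coeff.simps [simp del]

definition conv :: "nat \<Rightarrow> int \<Rightarrow> real \<Rightarrow> complex" where
  "conv n k t = (\<Sum>m\<le>n. \<Sum>j\<in>band m. coeff m j t * coeff (n - m) (k - j) t)"

lemma coeff_Suc:
  "coeff (Suc n) k t = - (\<i> * of_int k / 2) * (cis (- \<omega> k * t) *
     primitive (\<lambda>\<tau>. cis (\<omega> k * \<tau>) * conv n k \<tau>) t)"
  by (simp only: coeff.simps(2) conv_def)

text \<open>The right-hand side of the equation for a single mode and degree. Index 0 has no source
  term, since the part of degree one evolves linearly.\<close>

fun coeff_deriv :: "nat \<Rightarrow> int \<Rightarrow> real \<Rightarrow> complex" where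
  "coeff_deriv 0 k t = - \<i> * \<omega> k * coeff 0 k t"
| "coeff_deriv (Suc n) k t = - \<i> * \<omega> k * coeff (Suc n) k t - \<i> * of_int k / 2 * conv n k t"

lemma finite_band [simp]: "finite (band n)"
  by (simp add: band_def)

lemma card_band: "real (card (band n)) = 2 * real (Suc n * M) + 1"
  by (simp add: band_def del: mult_Suc of_nat_mult)

lemma uminus_band [simp]: "- k \<in> band n \<longleftrightarrow> k \<in> band n"
  by (auto simp: band_def)

text \<open>The widths add up: \<open>(m + 1) * M + (n - m + 1) * M = (n + 2) * M\<close>.\<close>

lemma band_add:
  assumes "j \<in> band m" "l \<in> band (n - m)" "m \<le> n"
  shows "j + l \<in> band (Suc n)"
proof -
  have "Suc m * M + Suc (n - m) * M = Suc (Suc n) * M"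
    using assms(3) by (metis Suc_diff_le add_Suc add_Suc_right add_mult_distrib le_add_diff_inverse)
  then have "int (Suc m * M) + int (Suc (n - m) * M) = int (Suc (Suc n) * M)"
    by linarith
  then show ?thesis using assms(1,2) unfolding band_def atLeastAtMost_iff by linarith
qed

lemma abs_le_of_band: "k \<in> band n \<Longrightarrow> \<bar>real_of_int k\<bar> \<le> real (Suc n * M)"
  unfolding band_def by (simp del: mult_Suc of_nat_mult) linarith

lemma continuous_on_conv:
  assumes "\<And>m k. m \<le> n \<Longrightarrow> continuous_on UNIV (coeff m k)"
  shows "continuous_on UNIV (conv n k)"
  unfolding conv_def[abs_def] by (intro continuous_on_sum continuous_on_mult assms) auto

text \<open>Continuity of \<open>conv\<close> is a hypothesis here because continuity of the
  coefficients is itself obtained by induction on the degree through this formula.\<close>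

lemma coeff_has_vector_derivative_aux:
  assumes "\<And>k. continuous_on UNIV (conv n k)"
  shows "(coeff (Suc n) k has_vector_derivative coeff_deriv (Suc n) k t) (at t)"
proof -
  define P where "P = primitive (\<lambda>\<tau>. cis (\<omega> k * \<tau>) * conv n k \<tau>)"
  have P: "(P has_vector_derivative cis (\<omega> k * t) * conv n k t) (at t)"
    unfolding P_def
    by (rule primitive_has_vector_derivative) (intro continuous_on_mult continuous_intros assms)
  have "((\<lambda>t. - (\<i> * of_int k / 2) * (cis (- \<omega> k * t) * P t)) has_vector_derivative
     - (\<i> * of_int k / 2) * (cis (- \<omega> k * t) * (cis (\<omega> k * t) * conv n k t)
       + (\<i> * of_real (- \<omega> k) * cis (- \<omega> k * t)) * P t)) (at t)"
    by (intro has_vector_derivative_mult_right has_vector_derivative_mult P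
        has_vector_derivative_cis[of "- \<omega> k"])
  moreover have "cis (- \<omega> k * t) * (cis (\<omega> k * t) * conv n k t) = conv n k t"
    by (simp add: mult.assoc[symmetric] cis_mult)
  moreover have "- (\<i> * k' / 2) * (E * (F * C) + (\<i> * - w * E) * p) =
      - \<i> * w * (- (\<i> * k' / 2) * (E * p)) - \<i> * k' / 2 * C"
    if "E * (F * C) = C" for E F C p k' w :: complex
    unfolding distrib_left that by (simp add: algebra_simps)
  ultimately show ?thesis
    unfolding coeff_Suc[abs_def] P_def[symmetric] coeff_deriv.simps by (simp only: of_real_minus)
qed

lemma continuous_on_coeff: "continuous_on UNIV (coeff n k)"
proof (induction n arbitrary: k rule: less_induct)
  case (less n)
  show ?case
  proof (cases n)
    case 0
    show ?thesis unfolding 0 coeff.simps by (intro continuous_intros)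
  next
    case (Suc m)
    have "continuous_on UNIV (conv m k)" for k
      by (rule continuous_on_conv) (use Suc less in auto)
    then show ?thesis
      unfolding Suc using coeff_has_vector_derivative_aux has_vector_derivative_continuous
      by (metis continuous_at_imp_continuous_on)
  qed
qed

lemma coeff_has_vector_derivative: "(coeff n k has_vector_derivative coeff_deriv n k t) (at t)"
proof (cases n)
  case 0
  have "((\<lambda>t. cis (- \<omega> k * t) * a k) has_vector_derivative
      (\<i> * of_real (- \<omega> k) * cis (- \<omega> k * t)) * a k) (at t)"
    by (intro has_vector_derivative_mult_left has_vector_derivative_cis[of "- \<omega> k"])
  then show ?thesis by (simp add: 0 coeff.simps(1)[abs_def] mult.assoc)
next
  case (Suc m)
  show ?thesis unfolding Suc
    by (intro coeff_has_vector_derivative_aux continuous_on_conv continuous_on_coeff)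
qed

lemma coeff_initial: "coeff n k 0 = (if n = 0 then a k else 0)"
  by (cases n) (simp_all add: coeff_Suc coeff.simps(1))

lemma coeff_mean [simp]: "coeff n 0 t = 0"
  by (cases n) (simp_all add: coeff_Suc coeff.simps(1) a_0)

lemma coeff_support: "k \<notin> band n \<Longrightarrow> coeff n k t = 0"
proof (induction n arbitrary: k t rule: less_induct)
  case (less n)
  show ?case
  proof (cases n)
    case 0
    then have "int M < \<bar>k\<bar>" using less.prems by (auto simp: band_def)
    then show ?thesis by (simp add: 0 coeff.simps(1) a_support)
  next
    case (Suc m)
    have "coeff i j \<tau> * coeff (m - i) (k - j) \<tau> = 0" if "i \<le> m" for i j \<tau>
    proof (cases "j \<in> band i \<and> k - j \<in> band (m - i)")
      case True
      then have "j + (k - j) \<in> band (Suc m)" using band_add that by blast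
      then show ?thesis using less.prems Suc by simp
    next
      case False
      then show ?thesis using less.IH[of i j \<tau>] less.IH[of "m - i" "k - j" \<tau>] that Suc
        by (auto simp: less_Suc_eq_le)
    qed
    then have "conv m k \<tau> = 0" for \<tau>
      unfolding conv_def by (intro sum.neutral ballI) auto
    then show ?thesis by (simp add: Suc coeff_Suc primitive_def)
  qed
qed

text \<open>The reflection of \<open>j\<close> to \<open>- j\<close> preserves each band, so the
  symmetry of the datum passes through the convolution; this makes the solution real.\<close>

lemma coeff_cnj: "coeff n (- k) t = cnj (coeff n k t)"
proof (induction n arbitrary: k t rule: less_induct)
  case (less n)
  show ?case
  proof (cases n)
    case 0
    then show ?thesis by (simp add: coeff.simps(1) \<omega>_odd a_cnj cis_cnj)
  next
    case (Suc m)
    have "conv m (- k) \<tau> = cnj (conv m k \<tau>)" for \<tau>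
    proof -
      have "(\<Sum>j\<in>band i. coeff i j \<tau> * coeff (m - i) (- k - j) \<tau>)
          = (\<Sum>j\<in>band i. cnj (coeff i j \<tau> * coeff (m - i) (k - j) \<tau>))" if i: "i \<le> m" for i
      proof (rule sum.reindex_bij_witness[of _ uminus uminus])
        fix j
        have "coeff i (- j) \<tau> = cnj (coeff i j \<tau>)" "coeff (m - i) (- (k + j)) \<tau> = cnj (coeff (m - i) (k + j) \<tau>)"
          using less.IH[of i j \<tau>] less.IH[of "m - i" "k + j" \<tau>] Suc i by simp_all
        then show "cnj (coeff i (- j) \<tau> * coeff (m - i) (k - - j) \<tau>) = coeff i j \<tau> * coeff (m - i) (- k - j) \<tau>"
          by simp
      qed auto
      then show ?thesis by (simp add: conv_def)
    qed
    then have "primitive (\<lambda>\<tau>. cis (\<omega> (- k) * \<tau>) * conv m (- k) \<tau>) t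
        = primitive (\<lambda>\<tau>. cnj (cis (\<omega> k * \<tau>) * conv m k \<tau>)) t"
      by (simp add: \<omega>_odd cis_cnj)
    then show ?thesis
      unfolding Suc coeff_Suc by (simp only: primitive_cnj) (simp add: \<omega>_odd cis_cnj)
  qed
qed

section \<open>Majorants in the absolute sum of Fourier coefficients\<close>

definition A :: real where
  "A = (\<Sum>k\<in>band 0. norm (a k))"

text \<open>Rescaled Catalan numbers: the value at \<open>n\<close> is
  \<open>A * (M * A) ^ n\<close> times the \<open>n\<close>-th Catalan number.\<close>

fun majorant :: "nat \<Rightarrow> real" where
  "majorant 0 = A"
| "majorant (Suc n) = M * (\<Sum>m\<le>n. majorant m * majorant (n - m))"

declare majorant.simps [simp del]

text \<open>Half the radius \<open>1 / (4 * M * A)\<close> of the majorant series, so that the parts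
  decay like \<open>(1 / 2) ^ n\<close> up to and including
  \<open>\<bar>t\<bar> = T\<close>.\<close>

definition T :: real where
  "T = 1 / (8 * M * A)"

lemma A_pos: "0 < A"
proof -
  obtain k where k: "a k \<noteq> 0" using a_nonzero by blast
  then have "\<bar>k\<bar> \<le> int M" using a_support[of k] by force
  then have "norm (a k) \<le> A"
    unfolding A_def by (intro member_le_sum) (auto simp: band_def)
  then show ?thesis using k by (smt (verit) zero_less_norm_iff)
qed

lemma T_pos: "0 < T"
  using A_pos M_pos by (simp add: T_def)

lemma majorant_nonneg: "0 \<le> majorant n"
proof (induction n rule: less_induct)
  case (less n)
  then show ?case
    using A_pos by (cases n) (auto simp: majorant.simps intro!: mult_nonneg_nonneg sum_nonneg)
qed

text \<open>Partial sums satisfy \<open>X' \<le> A + M * x * X ^ 2\<close>. At this \<open>x\<close>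
  the equation \<open>X = A + M * x * X ^ 2\<close> has the double root \<open>2 * A\<close>, so the
  bound \<open>2 * A\<close> reproduces itself.\<close>

lemma sum_majorant_le:
  assumes x: "x = 1 / (4 * M * A)"
  shows "(\<Sum>n\<le>P. majorant n * x ^ n) \<le> 2 * A"
proof (induction P)
  case 0
  then show ?case using A_pos by (simp add: majorant.simps)
next
  case (Suc P)
  define f where "f n = majorant n * x ^ n" for n
  have x_nonneg: "0 \<le> x" using A_pos by (simp add: x)
  have f_nonneg: "0 \<le> f n" for n
    by (simp add: f_def x_nonneg majorant_nonneg)
  have f_Suc: "f (Suc n) = M * x * (\<Sum>m\<le>n. f m * f (n - m))" for n
  proof -
    have "x ^ n * (majorant m * majorant (n - m)) = f m * f (n - m)" if "m \<le> n" for m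
      using that by (simp add: f_def flip: power_add[of x m "n - m", simplified])
    then show ?thesis
      by (simp add: f_def[of "Suc n"] majorant.simps sum_distrib_left sum_distrib_right mult_ac)
  qed
  have "(\<Sum>n\<le>Suc P. f n) = A + M * x * (\<Sum>n\<le>P. \<Sum>m\<le>n. f m * f (n - m))"
    by (simp only: sum.atMost_Suc_shift f_Suc sum_distrib_left) (simp add: f_def majorant.simps)
  also have "(\<Sum>n\<le>P. \<Sum>m\<le>n. f m * f (n - m)) = (\<Sum>(i, j)\<in>{(i, j). i + j \<le> P}. f i * f j)"
    by (rule sum.triangle_reindex_eq[symmetric])
  \<comment> \<open>Enlarging the triangle of index pairs to the square turns the Cauchy product
    into the square of the previous partial sum.\<close>
  also have "\<dots> \<le> (\<Sum>(i, j)\<in>{..P} \<times> {..P}. f i * f j)"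
    by (rule sum_mono2) (auto simp: f_nonneg)
  also have "\<dots> = (\<Sum>n\<le>P. f n) * (\<Sum>n\<le>P. f n)"
    by (simp add: sum_product sum.cartesian_product)
  also have "\<dots> \<le> (2 * A) * (2 * A)"
    using Suc A_pos by (intro mult_mono) (auto simp: f_def[symmetric] intro!: sum_nonneg f_nonneg)
  finally show ?case
    using A_pos M_pos x_nonneg by (simp add: f_def x mult_left_mono divide_simps)
qed

text \<open>A single nonnegative term is bounded by the partial sum, which replaces any closed form
  for the Catalan numbers.\<close>

lemma majorant_le: "majorant n \<le> 2 * A * (4 * M * A) ^ n"
proof -
  define x where "x = 1 / (4 * M * A)"
  have "majorant n * x ^ n \<le> (\<Sum>i\<le>n. majorant i * x ^ i)"
    by (rule member_le_sum) (use A_pos majorant_nonneg in \<open>auto simp: x_def\<close>)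
  also have "\<dots> \<le> 2 * A" using sum_majorant_le[OF x_def] .
  finally show ?thesis
    using A_pos M_pos by (simp add: x_def power_divide divide_simps split: if_splits)
qed

text \<open>Young's inequality for the convolution of two absolutely summable sequences; translating
  the frequency window cannot increase a sum, since each coefficient is supported in its
  band.\<close>

lemma sum_norm_conv_le:
  assumes IH: "\<And>m. m \<le> n \<Longrightarrow> (\<Sum>k\<in>band m. norm (coeff m k t)) \<le> majorant m * \<bar>t\<bar> ^ m"
  shows "(\<Sum>k\<in>band (Suc n). norm (conv n k t)) \<le> (\<Sum>m\<le>n. majorant m * majorant (n - m)) * \<bar>t\<bar> ^ n"
proof -
  have shift: "(\<Sum>k\<in>band (Suc n). norm (coeff i (k - j) t)) \<le> (\<Sum>k\<in>band i. norm (coeff i k t))" for i j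
  proof -
    have "(\<Sum>k\<in>band (Suc n). norm (coeff i (k - j) t)) = (\<Sum>k\<in>(\<lambda>k. k - j) ` band (Suc n). norm (coeff i k t))"
      by (subst sum.reindex) (auto simp: inj_on_def)
    also have "\<dots> = (\<Sum>k\<in>(\<lambda>k. k - j) ` band (Suc n) \<inter> band i. norm (coeff i k t))"
      by (rule sum.mono_neutral_right) (auto simp: coeff_support)
    also have "\<dots> \<le> (\<Sum>k\<in>band i. norm (coeff i k t))"
      by (rule sum_mono2) auto
    finally show ?thesis .
  qed
  have "(\<Sum>k\<in>band (Suc n). norm (conv n k t))
      \<le> (\<Sum>k\<in>band (Suc n). \<Sum>m\<le>n. \<Sum>j\<in>band m. norm (coeff m j t) * norm (coeff (n - m) (k - j) t))"
    unfolding conv_def by (intro sum_mono order_trans[OF norm_sum]) (simp add: norm_mult)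
  also have "\<dots> = (\<Sum>m\<le>n. \<Sum>j\<in>band m. \<Sum>k\<in>band (Suc n). norm (coeff m j t) * norm (coeff (n - m) (k - j) t))"
    by (subst sum.swap, rule sum.cong[OF refl], rule sum.swap)
  also have "\<dots> \<le> (\<Sum>m\<le>n. \<Sum>j\<in>band m. norm (coeff m j t) * (majorant (n - m) * \<bar>t\<bar> ^ (n - m)))"
    unfolding sum_distrib_left[symmetric]
    by (intro sum_mono mult_left_mono order_trans[OF shift IH]) auto
  also have "\<dots> \<le> (\<Sum>m\<le>n. (majorant m * \<bar>t\<bar> ^ m) * (majorant (n - m) * \<bar>t\<bar> ^ (n - m)))"
    unfolding sum_distrib_right[symmetric]
    by (intro sum_mono mult_right_mono IH) (auto simp: majorant_nonneg)
  also have "\<dots> = (\<Sum>m\<le>n. majorant m * majorant (n - m)) * \<bar>t\<bar> ^ n"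
  proof -
    have "(majorant m * \<bar>t\<bar> ^ m) * (majorant (n - m) * \<bar>t\<bar> ^ (n - m)) = majorant m * majorant (n - m) * \<bar>t\<bar> ^ n"
      if "m \<le> n" for m
      using that power_add[of "\<bar>t\<bar>" m "n - m"] by simp
    then show ?thesis unfolding sum_distrib_right by (intro sum.cong) auto
  qed
  finally show ?thesis .
qed

lemma sum_norm_primitive_le:
  assumes IH: "\<And>m t. m \<le> n \<Longrightarrow> (\<Sum>k\<in>band m. norm (coeff m k t)) \<le> majorant m * \<bar>t\<bar> ^ m"
  shows "(\<Sum>k\<in>band (Suc n). norm (primitive (\<lambda>\<tau>. cis (\<omega> k * \<tau>) * conv n k \<tau>) t))
    \<le> (\<Sum>m\<le>n. majorant m * majorant (n - m)) * \<bar>t\<bar> ^ Suc n / real (Suc n)"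
proof (rule sum_norm_le_of_vector_derivative_le_power)
  show "(primitive (\<lambda>\<tau>. cis (\<omega> k * \<tau>) * conv n k \<tau>) has_vector_derivative
      cis (\<omega> k * \<tau>) * conv n k \<tau>) (at \<tau>)" for k \<tau>
    by (rule primitive_has_vector_derivative)
      (intro continuous_on_mult continuous_intros continuous_on_conv continuous_on_coeff)
  show "(\<Sum>k\<in>band (Suc n). norm (cis (\<omega> k * \<tau>) * conv n k \<tau>))
      \<le> (\<Sum>m\<le>n. majorant m * majorant (n - m)) * \<bar>\<tau>\<bar> ^ n" for \<tau>
    using sum_norm_conv_le[OF IH] by (simp add: norm_mult)
qed simp

lemma sum_norm_coeff_le: "(\<Sum>k\<in>band n. norm (coeff n k t)) \<le> majorant n * \<bar>t\<bar> ^ n"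
proof (induction n arbitrary: t rule: less_induct)
  case (less n)
  show ?case
  proof (cases n)
    case 0
    then show ?thesis by (simp add: coeff.simps(1) majorant.simps A_def norm_mult)
  next
    case (Suc m)
    define S where "S = (\<Sum>i\<le>m. majorant i * majorant (m - i))"
    define R where "R = real (Suc n * M) / 2"
    define p where "p k = primitive (\<lambda>\<tau>. cis (\<omega> k * \<tau>) * conv m k \<tau>) t" for k
    have S_nonneg: "0 \<le> S" by (auto simp: S_def majorant_nonneg intro!: sum_nonneg)
    have R_nonneg: "0 \<le> R" by (simp add: R_def)
    have "(\<Sum>k\<in>band n. norm (coeff n k t)) \<le> (\<Sum>k\<in>band n. R * norm (p k))"
    proof (rule sum_mono)
      fix k assume "k \<in> band n"
      then have "norm (of_int k / 2 :: complex) \<le> R"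
        using abs_le_of_band[of k n] unfolding R_def by (simp add: norm_divide)
      then have "norm (of_int k / 2 :: complex) * norm (p k) \<le> R * norm (p k)"
        by (rule mult_right_mono) simp
      then show "norm (coeff n k t) \<le> R * norm (p k)"
        by (simp add: Suc coeff_Suc p_def norm_mult norm_divide)
    qed
    also have "\<dots> \<le> R * (S * \<bar>t\<bar> ^ Suc m / real (Suc m))"
      unfolding sum_distrib_left[symmetric] p_def S_def Suc
      by (intro mult_left_mono sum_norm_primitive_le less R_nonneg) (simp add: Suc)
    also have "\<dots> = (R / real (Suc m)) * (S * \<bar>t\<bar> ^ n)"
      by (simp add: Suc)
    \<comment> \<open>With \<open>n = Suc m\<close> the derivative costs
      \<open>(m + 2) * M / 2\<close> and the time integral gains \<open>1 / (m + 1)\<close>; the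
      product is at most \<open>M\<close>, as \<open>m + 2 \<le> 2 * (m + 1)\<close>.\<close>
    also have "\<dots> \<le> M * (S * \<bar>t\<bar> ^ n)"
      using S_nonneg by (intro mult_right_mono) (auto simp: R_def Suc divide_simps algebra_simps)
    finally show ?thesis by (simp add: Suc majorant.simps S_def)
  qed
qed

text \<open>Here the outer derivative is kept as the actual \<open>\<bar>k\<bar> / 2\<close> and not
  bounded by the width of the band. At the mode 1 this gains the factor \<open>1 / M\<close> on
  which the inflation rests.\<close>

lemma norm_coeff_Suc_le: "norm (coeff (Suc n) k t) \<le> \<bar>of_int k\<bar> / 2 * (majorant (Suc n) / M * \<bar>t\<bar> ^ Suc n)"
proof (cases "k \<in> band (Suc n)")
  case True
  define S where "S = (\<Sum>i\<le>n. majorant i * majorant (n - i))"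
  define p where "p k = primitive (\<lambda>\<tau>. cis (\<omega> k * \<tau>) * conv n k \<tau>) t" for k
  have "norm (p k) \<le> (\<Sum>k\<in>band (Suc n). norm (p k))"
    by (rule member_le_sum) (use True in auto)
  also have "\<dots> \<le> S * \<bar>t\<bar> ^ Suc n / real (Suc n)"
    unfolding p_def S_def by (intro sum_norm_primitive_le sum_norm_coeff_le)
  also have "\<dots> \<le> S * \<bar>t\<bar> ^ Suc n / 1"
    by (intro divide_left_mono) (auto simp: S_def majorant_nonneg intro!: sum_nonneg mult_nonneg_nonneg)
  finally have "\<bar>of_int k\<bar> / 2 * norm (p k) \<le> \<bar>of_int k\<bar> / 2 * (S * \<bar>t\<bar> ^ Suc n)"
    by (intro mult_left_mono) auto
  moreover have "majorant (Suc n) / M = S" using M_pos by (simp add: majorant.simps S_def)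
  ultimately show ?thesis by (simp add: coeff_Suc p_def norm_mult norm_divide)
next
  case False
  then show ?thesis
    using M_pos by (simp add: coeff_support majorant_nonneg)
qed

lemma norm_conv_le: "norm (conv n k t) \<le> majorant (Suc n) / M * \<bar>t\<bar> ^ n" if "k \<in> band (Suc n)"
proof -
  have "norm (conv n k t) \<le> (\<Sum>k\<in>band (Suc n). norm (conv n k t))"
    by (rule member_le_sum) (use that in auto)
  also have "\<dots> \<le> (\<Sum>m\<le>n. majorant m * majorant (n - m)) * \<bar>t\<bar> ^ n"
    by (intro sum_norm_conv_le sum_norm_coeff_le)
  finally show ?thesis using M_pos by (simp add: majorant.simps)
qed

lemma norm_coeff_le:
  assumes "\<bar>t\<bar> \<le> T"
  shows "norm (coeff n k t) \<le> 2 * A * (1 / 2) ^ n"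
proof (cases "k \<in> band n")
  case True
  have "norm (coeff n k t) \<le> (\<Sum>k\<in>band n. norm (coeff n k t))"
    by (rule member_le_sum) (use True in auto)
  also have "\<dots> \<le> majorant n * \<bar>t\<bar> ^ n" by (rule sum_norm_coeff_le)
  also have "\<dots> \<le> (2 * A * (4 * M * A) ^ n) * T ^ n"
    using assms A_pos by (intro mult_mono majorant_le power_mono) auto
  also have "\<dots> = 2 * A * ((4 * M * A) * T) ^ n"
    by (simp add: power_mult_distrib)
  also have "(4 * M * A) * T = 1 / 2"
    using A_pos M_pos by (simp add: T_def)
  finally show ?thesis .
qed (use A_pos in \<open>simp add: coeff_support\<close>)

lemma coeff_deriv_support:
  assumes "k \<notin> band n"
  shows "coeff_deriv n k t = 0"
proof -
  have "coeff n k = (\<lambda>t. 0)" using assms by (auto simp: coeff_support)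
  then show ?thesis
    using coeff_has_vector_derivative[of n k t]
    by (metis has_vector_derivative_const vector_derivative_unique_at)
qed

text \<open>The first summand accounts for the dispersive term, with
  \<open>\<bar>\<omega> k\<bar> \<le> (Suc n * M) ^ 3\<close>, the second for the
  nonlinearity.\<close>

definition deriv_const :: real where
  "deriv_const = 2 * A * M ^ 3 + 8 * A\<^sup>2 * M"

lemma norm_coeff_deriv_le:
  assumes "\<bar>t\<bar> \<le> T"
  shows "norm (coeff_deriv n k t) \<le> deriv_const * real (Suc n) ^ 3 * (1 / 2) ^ n"
proof -
  define R where "R = real (Suc n * M)"
  have deriv_const_nonneg: "0 \<le> deriv_const" using A_pos by (simp add: deriv_const_def)
  have "norm (- \<i> * \<omega> k * coeff n k t) \<le> R ^ 3 * (2 * A * (1 / 2) ^ n)" if "k \<in> band n"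
  proof -
    have "\<bar>\<omega> k\<bar> \<le> R ^ 3"
      using \<omega>_le[of k] power_mono[OF abs_le_of_band[OF that], of 3] unfolding R_def by linarith
    then have "\<bar>\<omega> k\<bar> * norm (coeff n k t) \<le> R ^ 3 * (2 * A * (1 / 2) ^ n)"
      by (intro mult_mono norm_coeff_le assms) (auto simp: R_def)
    then show ?thesis by (simp add: norm_mult)
  qed
  note linear = this
  show ?thesis
  proof (cases "k \<in> band n")
    case True
    show ?thesis
    proof (cases n)
      case 0
      have "R ^ 3 * (2 * A * (1 / 2) ^ n) \<le> deriv_const * real (Suc n) ^ 3 * (1 / 2) ^ n"
        by (simp add: 0 R_def deriv_const_def algebra_simps)
      then show ?thesis using linear[OF True] 0 by simp
    next
      case (Suc m)
      have "norm (conv m k t) \<le> majorant (Suc m) / M * \<bar>t\<bar> ^ m"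
        using norm_conv_le True Suc by simp
      also have "\<dots> \<le> (2 * A * (4 * M * A) ^ Suc m) / M * T ^ m"
        using assms A_pos by (intro mult_mono divide_right_mono majorant_le power_mono) auto
      also have "\<dots> = 8 * A\<^sup>2 * (4 * M * A * T) ^ m"
        using M_pos by (simp add: power_mult_distrib power2_eq_square)
      also have "4 * M * A * T = 1 / 2"
        using A_pos M_pos by (simp add: T_def)
      also have "(1 / 2 :: real) ^ m = 2 * (1 / 2) ^ n" by (simp add: Suc)
      finally have "norm (of_int k :: complex) * norm (conv m k t) \<le> R * (8 * A\<^sup>2 * (2 * (1 / 2) ^ n))"
        using abs_le_of_band[OF True] by (intro mult_mono) (auto simp: R_def)
      then have "norm (\<i> * of_int k / 2 * conv m k t) \<le> R * (8 * A\<^sup>2) * (1 / 2) ^ n"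
        by (simp add: norm_mult norm_divide)
      also have "\<dots> \<le> (real (Suc n) ^ 3 * (8 * A\<^sup>2 * M)) * (1 / 2) ^ n"
      proof -
        have "real (Suc n) * (8 * A\<^sup>2 * M) \<le> real (Suc n) ^ 3 * (8 * A\<^sup>2 * M)"
          using power_increasing[of 1 3 "real (Suc n)"] by (intro mult_right_mono) simp_all
        moreover have "R * (8 * A\<^sup>2) = real (Suc n) * (8 * A\<^sup>2 * M)"
          by (simp add: R_def algebra_simps)
        ultimately have "R * (8 * A\<^sup>2) \<le> real (Suc n) ^ 3 * (8 * A\<^sup>2 * M)" by linarith
        then show ?thesis by (rule mult_right_mono) simp
      qed
      finally have "norm (coeff_deriv n k t) \<le> R ^ 3 * (2 * A * (1 / 2) ^ n)
          + (real (Suc n) ^ 3 * (8 * A\<^sup>2 * M)) * (1 / 2) ^ n"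
        using linear[OF True] norm_triangle_ineq4[of "- \<i> * \<omega> k * coeff n k t" "\<i> * of_int k / 2 * conv m k t"]
        unfolding Suc coeff_deriv.simps by linarith
      also have "\<dots> = deriv_const * real (Suc n) ^ 3 * (1 / 2) ^ n"
        by (simp only: R_def deriv_const_def of_nat_mult of_nat_power power_mult_distrib) (simp only: algebra_simps)
      finally show ?thesis .
    qed
  next
    case False
    then show ?thesis using deriv_const_nonneg by (simp add: coeff_deriv_support)
  qed
qed

subsection \<open>Summation of the expansion\<close>

text \<open>The parameter \<open>p\<close> counts derivatives in \<open>x\<close>, which makes the
  family closed under differentiation and gives all derivatives of the series at once.\<close>

definition part :: "nat \<Rightarrow> nat \<Rightarrow> real \<Rightarrow> real \<Rightarrow> complex" where
  "part p n t x = (\<Sum>k\<in>band n. (\<i> * of_int k) ^ p * coeff n k t * cis (of_int k * x))"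

definition series :: "nat \<Rightarrow> real \<Rightarrow> real \<Rightarrow> complex" where
  "series p t x = (\<Sum>n. part p n t x)"

text \<open>Taking the real part only adjusts the type: \<open>series_real\<close> shows that
  nothing is discarded for \<open>\<bar>t\<bar> \<le> T\<close>.\<close>

definition u :: "real \<Rightarrow> real \<Rightarrow> real" where
  "u t x = Re (series 0 t x)"

definition mode :: "int \<Rightarrow> real \<Rightarrow> complex" where
  "mode k t = (\<Sum>n. coeff n k t)"

definition part_deriv :: "nat \<Rightarrow> real \<Rightarrow> real \<Rightarrow> complex" where
  "part_deriv n t x = (\<Sum>k\<in>band n. coeff_deriv n k t * cis (of_int k * x))"

definition dispersive_part :: "nat \<Rightarrow> real \<Rightarrow> real \<Rightarrow> complex" where
  "dispersive_part n t x = (\<Sum>k\<in>band n. \<i> * \<omega> k * coeff n k t * cis (of_int k * x))"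

lemma norm_trig_sum_le:
  fixes g :: "int \<Rightarrow> complex" and C :: real
  assumes "\<And>k. k \<in> band n \<Longrightarrow> norm (g k) \<le> geometric_bound C q n"
  shows "(\<Sum>k\<in>band n. norm (g k)) \<le> geometric_bound (3 * real M * C) (Suc q) n"
proof -
  have C: "0 \<le> geometric_bound C q n"
  proof -
    have "0 \<in> band n" by (simp add: band_def del: mult_Suc of_nat_mult)
    then show ?thesis using order_trans[OF norm_ge_zero assms] by blast
  qed
  have "(\<Sum>k\<in>band n. norm (g k)) \<le> real (card (band n)) * geometric_bound C q n"
    using sum_bounded_above[of "band n" "\<lambda>k. norm (g k)"] assms by simp
  \<comment> \<open>The band has \<open>2 * Suc n * M + 1\<close> elements, and
    \<open>1 \<le> Suc n * M\<close> absorbs the summand 1.\<close>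
  also have "\<dots> \<le> (3 * real (Suc n * M)) * geometric_bound C q n"
  proof (rule mult_right_mono[OF _ C])
    have "1 \<le> Suc n * M" using M_pos by simp
    then have "1 \<le> real (Suc n * M)" by (metis of_nat_1 of_nat_mono)
    then show "real (card (band n)) \<le> 3 * real (Suc n * M)"
      unfolding card_band by linarith
  qed
  finally show ?thesis
    by (simp only: geometric_bound_def of_nat_mult power_Suc mult_ac)
qed

lemma norm_weighted_coeff_le:
  assumes "\<bar>t\<bar> \<le> T" "k \<in> band n"
  shows "\<bar>of_int k\<bar> ^ p * norm (coeff n k t) \<le> geometric_bound (real M ^ p * (2 * A)) p n"
proof -
  have "\<bar>of_int k\<bar> ^ p * norm (coeff n k t) \<le> real (Suc n * M) ^ p * (2 * A * (1 / 2) ^ n)"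
    using assms by (intro mult_mono norm_coeff_le power_mono abs_le_of_band) auto
  then show ?thesis by (simp only: geometric_bound_def of_nat_mult of_nat_power power_mult_distrib mult_ac)
qed

lemma norm_weighted_coeff_deriv_le:
  assumes "\<bar>t\<bar> \<le> T" "k \<in> band n"
  shows "\<bar>of_int k\<bar> ^ p * norm (coeff_deriv n k t) \<le> geometric_bound (real M ^ p * deriv_const) (p + 3) n"
proof -
  have "\<bar>of_int k\<bar> ^ p * norm (coeff_deriv n k t) \<le> real (Suc n * M) ^ p * (deriv_const * real (Suc n) ^ 3 * (1 / 2) ^ n)"
    using assms by (intro mult_mono norm_coeff_deriv_le power_mono abs_le_of_band) auto
  then show ?thesis
    by (simp only: geometric_bound_def of_nat_mult of_nat_power power_mult_distrib power_add mult_ac)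
qed

lemma norm_part_le:
  assumes "\<bar>t\<bar> \<le> T"
  shows "norm (part p n t x) \<le> geometric_bound (3 * real M * (real M ^ p * (2 * A))) (Suc p) n"
proof -
  have "(\<Sum>k\<in>band n. norm ((\<i> * of_int k) ^ p * coeff n k t * cis (of_int k * x)))
      \<le> geometric_bound (3 * real M * (real M ^ p * (2 * A))) (Suc p) n"
    by (intro norm_trig_sum_le)
      (use norm_weighted_coeff_le[OF assms] in \<open>simp add: norm_mult norm_power\<close>)
  then show ?thesis unfolding part_def by (rule order_trans[OF norm_sum])
qed

lemma norm_part_deriv_le:
  assumes "\<bar>t\<bar> \<le> T"
  shows "norm (part_deriv n t x) \<le> geometric_bound (3 * real M * deriv_const) 4 n"
proof -
  have "(\<Sum>k\<in>band n. norm (coeff_deriv n k t * cis (of_int k * x))) \<le> geometric_bound (3 * real M * deriv_const) (Suc 3) n"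
    by (intro norm_trig_sum_le)
      (use norm_weighted_coeff_deriv_le[OF assms, where p = 0] in \<open>simp add: norm_mult\<close>)
  then show ?thesis unfolding part_deriv_def by (simp add: order_trans[OF norm_sum])
qed

lemma sum_norm_dispersive_part_le:
  assumes "\<bar>t\<bar> \<le> T"
  shows "(\<Sum>k\<in>band n. norm (\<i> * \<omega> k * coeff n k t * cis (of_int k * x)))
    \<le> geometric_bound (3 * real M * (real M ^ 3 * (2 * A))) 4 n"
proof -
  have "norm (\<i> * \<omega> k * coeff n k t * cis (of_int k * x)) \<le> geometric_bound (real M ^ 3 * (2 * A)) 3 n"
    if "k \<in> band n" for k
  proof -
    have "norm (\<i> * \<omega> k * coeff n k t * cis (of_int k * x)) = \<bar>\<omega> k\<bar> * norm (coeff n k t)"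
      by (simp add: norm_mult)
    also have "\<dots> \<le> \<bar>of_int k\<bar> ^ 3 * norm (coeff n k t)"
      by (intro mult_right_mono \<omega>_le) auto
    also have "\<dots> \<le> geometric_bound (real M ^ 3 * (2 * A)) 3 n"
      using norm_weighted_coeff_le[OF assms that] .
    finally show ?thesis .
  qed
  then show ?thesis using norm_trig_sum_le[of n _ "real M ^ 3 * (2 * A)" 3] by simp
qed

lemma norm_dispersive_part_le:
  assumes "\<bar>t\<bar> \<le> T"
  shows "norm (dispersive_part n t x) \<le> geometric_bound (3 * real M * (real M ^ 3 * (2 * A))) 4 n"
  unfolding dispersive_part_def by (rule order_trans[OF norm_sum sum_norm_dispersive_part_le[OF assms]])

lemma summable_norm_part: "\<bar>t\<bar> \<le> T \<Longrightarrow> summable (\<lambda>n. norm (part p n t x))"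
  by (rule summable_comparison_test'[OF summable_geometric_bound]) (simp, erule norm_part_le)

lemma summable_part: "\<bar>t\<bar> \<le> T \<Longrightarrow> summable (\<lambda>n. part p n t x)"
  by (rule summable_norm_cancel[OF summable_norm_part])

lemma summable_dispersive_part:
  assumes "\<bar>t\<bar> \<le> T"
  shows "summable (\<lambda>n. dispersive_part n t x)"
  using norm_dispersive_part_le[OF assms] by (rule summable_comparison_test'[OF summable_geometric_bound])

lemma summable_part_deriv:
  assumes "\<bar>t\<bar> \<le> T"
  shows "summable (\<lambda>n. part_deriv n t x)"
  using norm_part_deriv_le[OF assms] by (rule summable_comparison_test'[OF summable_geometric_bound])

lemma part_has_vector_derivative: "(part p n t has_vector_derivative part (Suc p) n t x) (at x)"
proof -
  have "((\<lambda>x. \<Sum>k\<in>band n. (\<i> * of_int k) ^ p * coeff n k t * cis (of_int k * x)) has_vector_derivative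
    (\<Sum>k\<in>band n. (\<i> * of_int k) ^ p * coeff n k t * (\<i> * of_real (of_int k) * cis (of_int k * x)))) (at x)"
    by (intro has_vector_derivative_sum has_vector_derivative_mult_right has_vector_derivative_cis)
  then show ?thesis by (simp add: part_def[abs_def] mult_ac)
qed

lemma series_has_vector_derivative:
  assumes "\<bar>t\<bar> \<le> T"
  shows "(series p t has_vector_derivative series (Suc p) t x) (at x)"
  unfolding series_def[abs_def]
  by (rule has_vector_derivative_suminf[where S = UNIV, OF _ _ part_has_vector_derivative
        norm_part_le[OF assms] summable_geometric_bound summable_part[OF assms]]) auto

lemma series_real:
  assumes "\<bar>t\<bar> \<le> T"
  shows "of_real (Re (series p t x)) = series p t x"
proof -
  have "cnj (part p n t x) = part p n t x" for n
    unfolding part_def cnj_sum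
    by (rule sum.reindex_bij_witness[of _ uminus uminus]) (auto simp: coeff_cnj cis_cnj)
  then have "Im (cnj (part p n t x)) = Im (part p n t x)" for n
    by (rule arg_cong)
  then have "Im (part p n t x) = 0" for n
    by simp
  then have "Im (series p t x) = 0"
    unfolding series_def by (simp add: bounded_linear.suminf[OF bounded_linear_Im summable_part[OF assms]])
  then show ?thesis by (simp add: complex_eq_iff)
qed

lemma u_has_real_derivative:
  assumes "\<bar>t\<bar> \<le> T"
  shows "((\<lambda>x. Re (series p t x)) has_real_derivative Re (series (Suc p) t x)) (at x)"
  using bounded_linear.has_vector_derivative[OF bounded_linear_Re series_has_vector_derivative[OF assms]]
  by (simp add: has_real_derivative_iff_has_vector_derivative)

lemma deriv_u:
  assumes "\<bar>t\<bar> \<le> T"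
  shows "(deriv ^^ p) (u t) = (\<lambda>x. Re (series p t x))"
proof (induction p)
  case 0
  show ?case by (auto simp: u_def)
next
  case (Suc p)
  then show ?case
    using DERIV_imp_deriv[OF u_has_real_derivative[OF assms]] by auto
qed

lemma periodic_u: "periodic (u t)"
proof -
  have "cis (of_int k * (x + 2 * pi)) = cis (of_int k * x)" for k :: int and x
  proof -
    have "cis (of_int k * (x + 2 * pi)) = cis (of_int k * x) * cis (2 * pi * of_int k)"
      by (simp add: cis_mult algebra_simps)
    then show ?thesis by (simp add: cis_multiple_2pi)
  qed
  then show ?thesis by (simp add: periodic_def u_def series_def part_def)
qed

lemma smooth_u:
  assumes "\<bar>t\<bar> \<le> T"
  shows "u t \<in> smooth_torus"
proof -
  have "(deriv ^^ n) (u t) field_differentiable at x" for n x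
    unfolding deriv_u[OF assms] field_differentiable_def
    using u_has_real_derivative[OF assms] by blast
  then show ?thesis using periodic_u by (auto simp: smooth_torus_def)
qed

lemma continuous_u:
  assumes "\<bar>t\<bar> \<le> T"
  shows "continuous_on S (u t)"
  unfolding u_def[abs_def]
  by (intro continuous_at_imp_continuous_on ballI DERIV_isCont[OF u_has_real_derivative[OF assms]])

lemma series_has_vector_derivative_time:
  assumes "\<bar>t\<bar> < T"
  shows "((\<lambda>t. series 0 t x) has_vector_derivative (\<Sum>n. part_deriv n t x)) (at t)"
  unfolding series_def
proof (rule has_vector_derivative_suminf[where S = "{-T<..<T}"])
  show "((\<lambda>t. part 0 n t x) has_vector_derivative part_deriv n \<tau> x) (at \<tau>)" for n \<tau>
    unfolding part_def part_deriv_def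
    by (simp, intro has_vector_derivative_sum has_vector_derivative_mult_left coeff_has_vector_derivative)
  show "norm (part_deriv n \<tau> x) \<le> geometric_bound (3 * real M * deriv_const) 4 n" if "\<tau> \<in> {-T<..<T}" for n \<tau>
    using that by (intro norm_part_deriv_le) auto
  show "summable (\<lambda>n. part 0 n \<tau> x)" if "\<tau> \<in> {-T<..<T}" for \<tau>
    using that by (intro summable_part) auto
qed (use assms summable_geometric_bound in auto)

text \<open>The identity between half the derivative of the square and the product of the function
  with its derivative, separately in each degree. Symmetrizing the two factors produces
  \<open>j + l = k\<close>, so that the derivative acts on the output frequency.\<close>

lemma sum_conv:
  "(\<Sum>k\<in>band (Suc n). \<i> * of_int k / 2 * conv n k t * cis (of_int k * x))
    = (\<Sum>m\<le>n. part 0 m t x * part 1 (n - m) t x)"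
proof -
  define e where "e k = cis (of_int k * x)" for k
  have shift: "(\<Sum>l\<in>band (n - m). coeff (n - m) l t * F (j + l))
      = (\<Sum>k\<in>band (Suc n). coeff (n - m) (k - j) t * F k)"
    if "m \<le> n" "j \<in> band m" for m j and F :: "int \<Rightarrow> complex"
  proof -
    have "(\<Sum>l\<in>band (n - m). coeff (n - m) l t * F (j + l))
        = (\<Sum>k\<in>(+) j ` band (n - m). coeff (n - m) (k - j) t * F k)"
      by (subst sum.reindex) auto
    also have "\<dots> = (\<Sum>k\<in>band (Suc n). coeff (n - m) (k - j) t * F k)"
    proof (rule sum.mono_neutral_left)
      show "(+) j ` band (n - m) \<subseteq> band (Suc n)" using that band_add by blast
      have "k - j \<notin> band (n - m)" if "k \<notin> (+) j ` band (n - m)" for k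
        using that by (metis add.commute diff_add_cancel imageI)
      then show "\<forall>k\<in>band (Suc n) - (+) j ` band (n - m). coeff (n - m) (k - j) t * F k = 0"
        by (auto simp: coeff_support)
    qed simp
    finally show ?thesis .
  qed
  \<comment> \<open>Reversing the order of \<open>m\<close> moves the derivative to the other
    factor; averaging both forms explains the factor 1/2 in \<open>coeff\<close>.\<close>
  have "(\<Sum>m\<le>n. part 0 m t x * part 1 (n - m) t x) = (\<Sum>m\<le>n. part 1 m t x * part 0 (n - m) t x)"
    by (subst sum.atLeastAtMost_rev[of _ 0 n, folded atMost_atLeast0])
      (auto intro!: sum.cong simp: mult.commute)
  then have "2 * (\<Sum>m\<le>n. part 0 m t x * part 1 (n - m) t x)
      = (\<Sum>m\<le>n. part 0 m t x * part 1 (n - m) t x + part 1 m t x * part 0 (n - m) t x)"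
    by (simp add: sum.distrib)
  also have "\<dots> = (\<Sum>m\<le>n. \<Sum>j\<in>band m. \<Sum>k\<in>band (Suc n).
      coeff m j t * coeff (n - m) (k - j) t * (\<i> * of_int k * e k))"
  proof (intro sum.cong refl)
    fix m assume m: "m \<in> {..n}"
    have "part 0 m t x * part 1 (n - m) t x + part 1 m t x * part 0 (n - m) t x
        = (\<Sum>j\<in>band m. coeff m j t * (\<Sum>l\<in>band (n - m). coeff (n - m) l t * (\<i> * of_int (j + l) * e (j + l))))"
    proof -
      have "e (j + l) = e j * e l" for j l
        by (simp add: e_def cis_mult algebra_simps)
      then show ?thesis
        unfolding part_def e_def[symmetric] sum_product
        unfolding sum_distrib_left sum.distrib[symmetric]
        by (intro sum.cong refl) (simp add: algebra_simps)
    qed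
    also have "\<dots> = (\<Sum>j\<in>band m. coeff m j t * (\<Sum>k\<in>band (Suc n). coeff (n - m) (k - j) t * (\<i> * of_int k * e k)))"
      using m by (intro sum.cong refl arg_cong2[where f = "(*)"] shift) auto
    finally show "part 0 m t x * part 1 (n - m) t x + part 1 m t x * part 0 (n - m) t x
        = (\<Sum>j\<in>band m. \<Sum>k\<in>band (Suc n). coeff m j t * coeff (n - m) (k - j) t * (\<i> * of_int k * e k))"
      by (simp add: sum_distrib_left mult_ac)
  qed
  also have "\<dots> = (\<Sum>m\<le>n. \<Sum>k\<in>band (Suc n). \<Sum>j\<in>band m.
      coeff m j t * coeff (n - m) (k - j) t * (\<i> * of_int k * e k))"
    by (intro sum.cong refl sum.swap)
  also have "\<dots> = (\<Sum>k\<in>band (Suc n). \<Sum>m\<le>n. \<Sum>j\<in>band m.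
      coeff m j t * coeff (n - m) (k - j) t * (\<i> * of_int k * e k))"
    by (rule sum.swap)
  also have "\<dots> = (\<Sum>k\<in>band (Suc n). conv n k t * (\<i> * of_int k * e k))"
    by (simp add: conv_def sum_distrib_right)
  also have "\<dots> = 2 * (\<Sum>k\<in>band (Suc n). \<i> * of_int k / 2 * conv n k t * e k)"
    by (simp add: sum_distrib_left mult_ac)
  finally show ?thesis by (simp add: e_def)
qed

text \<open>The nonlinear term is a Cauchy product of absolutely convergent series. Its part
  \<open>N n\<close> balances the index \<open>Suc n\<close> of the linear terms, and index 0
  balances by itself, being the free evolution.\<close>

lemma evolution:
  assumes "\<bar>t\<bar> \<le> T"
  shows "(\<Sum>n. part_deriv n t x) + (\<Sum>n. dispersive_part n t x) + series 0 t x * series 1 t x = 0"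
proof -
  define N where "N n = (\<Sum>m\<le>n. part 0 m t x * part 1 (n - m) t x)" for n
  have "N sums (series 0 t x * series 1 t x)"
    unfolding N_def[abs_def] series_def by (intro Cauchy_product_sums summable_norm_part assms)
  then have "(\<lambda>n. - N n) sums - (series 0 t x * series 1 t x)"
    by (rule sums_minus)
  moreover have "part_deriv (Suc n) t x + dispersive_part (Suc n) t x = - N n" for n
    unfolding N_def sum_conv[symmetric] sum_negf[symmetric] part_deriv_def dispersive_part_def sum.distrib[symmetric]
    by (intro sum.cong refl) (simp add: algebra_simps)
  ultimately have "(\<lambda>n. part_deriv (Suc n) t x + dispersive_part (Suc n) t x) sums - (series 0 t x * series 1 t x)"
    by simp
  then have "(\<lambda>n. part_deriv n t x + dispersive_part n t x) sums (- (series 0 t x * series 1 t x) + (part_deriv 0 t x + dispersive_part 0 t x))"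
    by (rule sums_Suc)
  moreover have "part_deriv 0 t x + dispersive_part 0 t x = 0"
    unfolding part_deriv_def dispersive_part_def sum.distrib[symmetric]
    by (intro sum.neutral ballI) (simp add: algebra_simps)
  ultimately have "(\<lambda>n. part_deriv n t x + dispersive_part n t x) sums - (series 0 t x * series 1 t x)"
    by simp
  then show ?thesis
    using suminf_add[OF summable_part_deriv[OF assms] summable_dispersive_part[OF assms]] by (simp add: sums_iff)
qed

lemma u_solves:
  assumes "\<bar>t\<bar> < T"
  shows "(\<lambda>\<tau>. u \<tau> x) differentiable at t"
    and "of_real (deriv (\<lambda>\<tau>. u \<tau> x) t) + (\<Sum>n. dispersive_part n t x) + of_real (u t x * deriv (u t) x) = 0"
proof -
  have t: "\<bar>t\<bar> \<le> T" using assms by simp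
  have u': "((\<lambda>\<tau>. u \<tau> x) has_real_derivative Re (\<Sum>n. part_deriv n t x)) (at t)"
    using bounded_linear.has_vector_derivative[OF bounded_linear_Re series_has_vector_derivative_time[OF assms]]
    by (simp add: u_def has_real_derivative_iff_has_vector_derivative)
  then show "(\<lambda>\<tau>. u \<tau> x) differentiable at t"
    using real_differentiable_def by blast
  have "((\<lambda>\<tau>. complex_of_real (u \<tau> x)) has_vector_derivative (\<Sum>n. part_deriv n t x)) (at t)"
  proof (rule has_vector_derivative_transform_within_open[OF series_has_vector_derivative_time[OF assms]])
    show "open {-T<..<T}" "t \<in> {-T<..<T}" using assms by auto
    show "series 0 y x = of_real (u y x)" if "y \<in> {-T<..<T}" for y
      using that series_real[of y 0 x] by (auto simp: u_def)
  qed
  \<comment> \<open>The same function is differentiated in two ways; uniqueness of the derivative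
    shows that the complex series is real.\<close>
  moreover have "((\<lambda>\<tau>. complex_of_real (u \<tau> x)) has_vector_derivative of_real (Re (\<Sum>n. part_deriv n t x))) (at t)"
    using u' by (intro has_vector_derivative_of_real)
      (simp add: has_real_derivative_iff_has_vector_derivative)
  ultimately have "of_real (Re (\<Sum>n. part_deriv n t x)) = (\<Sum>n. part_deriv n t x)"
    by (rule vector_derivative_unique_at[symmetric])
  moreover have "of_real (u t x * deriv (u t) x) = series 0 t x * series 1 t x"
    using deriv_u[OF t, of 1] series_real[OF t] by (simp add: u_def)
  ultimately show "of_real (deriv (\<lambda>\<tau>. u \<tau> x) t) + (\<Sum>n. dispersive_part n t x) + of_real (u t x * deriv (u t) x) = 0"
    using DERIV_imp_deriv[OF u'] evolution[OF t] by simp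
qed

subsection \<open>Fourier coefficients of the solution\<close>

lemma integral_part:
  "((\<lambda>x. part 0 n t x * cis (- (of_int k * x))) has_integral 2 * pi * coeff n k t) {-pi..pi}"
proof -
  have "((\<lambda>x. \<Sum>j\<in>band n. coeff n j t * cis (of_int (j - k) * x)) has_integral
      (\<Sum>j\<in>band n. coeff n j t * (if j - k = 0 then 2 * pi else 0))) {-pi..pi}"
    unfolding integral_cis[symmetric]
    by (intro has_integral_sum has_integral_mult_right integrable_integral
        integrable_continuous_real continuous_intros) auto
  also have "(\<lambda>x. \<Sum>j\<in>band n. coeff n j t * cis (of_int (j - k) * x))
      = (\<lambda>x. part 0 n t x * cis (- (of_int k * x)))"
    by (simp add: part_def sum_distrib_right mult.assoc cis_mult left_diff_distrib)
  also have "(\<Sum>j\<in>band n. coeff n j t * (if j - k = 0 then 2 * pi else 0)) = 2 * pi * coeff n k t"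
    by (simp add: if_distrib sum.delta' coeff_support cong: if_cong)
  finally show ?thesis .
qed

text \<open>The parts converge uniformly in \<open>x\<close>, so summation and integration commute,
  and orthogonality picks out one coefficient of each part.\<close>

lemma fourier_coeff_u:
  assumes "\<bar>t\<bar> \<le> T"
  shows "fourier_coeff (u t) k = mode k t"
proof -
  define g where "g n x = part 0 n t x * cis (- (of_int k * x))" for n x
  have "norm (g n x) \<le> geometric_bound (3 * real M * (real M ^ 0 * (2 * A))) (Suc 0) n" for n x
    using norm_part_le[OF assms, of 0] by (simp add: g_def norm_mult)
  then have "uniform_limit {-pi..pi} (\<lambda>N x. \<Sum>n<N. g n x) (\<lambda>x. \<Sum>n. g n x) sequentially"
    by (rule Weierstrass_m_test[OF _ summable_geometric_bound])
  moreover have "continuous_on {-pi..pi} (\<lambda>x. \<Sum>n<N. g n x)" for N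
    unfolding g_def part_def by (intro continuous_intros)
  ultimately obtain I J where I: "\<And>N. ((\<lambda>x. \<Sum>n<N. g n x) has_integral I N) {-pi..pi}"
    and J: "((\<lambda>x. \<Sum>n. g n x) has_integral J) {-pi..pi}" and lim: "I \<longlonglongrightarrow> J"
    by (rule uniform_limit_integral) auto
  have "((\<lambda>x. \<Sum>n<N. g n x) has_integral (\<Sum>n<N. 2 * pi * coeff n k t)) {-pi..pi}" for N
    unfolding g_def by (intro has_integral_sum integral_part) auto
  then have "I = (\<lambda>N. \<Sum>n<N. 2 * pi * coeff n k t)"
    using I has_integral_unique by blast
  then have "(\<lambda>n. 2 * pi * coeff n k t) sums J"
    using lim by (simp add: sums_def)
  then have "(\<lambda>n. 1 / (2 * pi) * (2 * pi * coeff n k t)) sums (1 / (2 * pi) * J)"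
    by (rule sums_mult)
  then have mode: "mode k t = 1 / (2 * pi) * J"
    by (simp add: mode_def sums_iff)
  have "(\<Sum>n. g n x) = of_real (u t x) * cis (- (of_int k * x))" for x
    using suminf_mult2[OF summable_part[OF assms], of 0 x "cis (- (of_int k * x))"] series_real[OF assms, of 0 x]
    by (simp add: g_def u_def series_def)
  then show ?thesis
    using J mode by (simp add: fourier_coeff_def integral_unique)
qed

text \<open>The multiplier sums over frequencies outside and degrees inside, the expansion the other
  way round. Absolute summability over pairs allows the exchange; for fixed degree only the finitely
  many frequencies of a band contribute.\<close>

lemma fourier_multiplier_u:
  assumes "\<bar>t\<bar> \<le> T"
  shows "fourier_multiplier (\<lambda>k. \<i> * of_real (\<omega> k)) (u t) x = (\<Sum>n. dispersive_part n t x)"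
proof -
  define f where "f n k = \<i> * \<omega> k * coeff n k t * cis (of_int k * x)" for n k
  have zero: "f n k = 0" if "k \<notin> band n" for n k
    using that by (simp add: f_def coeff_support)
  have dispersive_part: "(\<Sum>\<^sub>\<infinity>k. f n k) = dispersive_part n t x" for n
    using infsum_finite_support[OF finite_band zero] by (simp add: dispersive_part_def f_def)
  have norm_dispersive_part: "summable (\<lambda>n. \<Sum>k\<in>band n. norm (f n k))"
    by (rule summable_comparison_test'[OF summable_geometric_bound, of 0])
      (use sum_norm_dispersive_part_le[OF assms] in \<open>simp add: f_def sum_nonneg\<close>)
  have "(\<lambda>p. norm (case p of (n, k) \<Rightarrow> f n k)) summable_on UNIV \<times> UNIV"
    unfolding Infinite_Sum.abs_summable_on_Sigma_iff
  proof (intro conjI ballI)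
    show "(\<lambda>k. norm (case (n, k) of (n, k) \<Rightarrow> f n k)) summable_on UNIV" for n
      using summable_on_cong_neutral[of "band n" UNIV "\<lambda>k. norm (f n k)" "\<lambda>k. norm (f n k)"]
      by (auto simp: zero)
    have "(\<Sum>\<^sub>\<infinity>k. norm (f n k)) = (\<Sum>k\<in>band n. norm (f n k))" for n
      by (rule infsum_finite_support) (auto simp: zero)
    then show "(\<lambda>n. norm (\<Sum>\<^sub>\<infinity>k. norm (case (n, k) of (n, k) \<Rightarrow> f n k))) summable_on UNIV"
      using norm_dispersive_part by (simp add: norm_summable_imp_summable_on sum_nonneg)
  qed
  then have "(\<lambda>(n, k). f n k) summable_on UNIV \<times> UNIV"
    by (rule abs_summable_summable)
  then have swap: "(\<Sum>\<^sub>\<infinity>n. \<Sum>\<^sub>\<infinity>k. f n k) = (\<Sum>\<^sub>\<infinity>k. \<Sum>\<^sub>\<infinity>n. f n k)"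
    by (rule infsum_swap_banach)
  have "(\<Sum>\<^sub>\<infinity>n. f n k) = \<i> * \<omega> k * fourier_coeff (u t) k * cis (of_int k * x)" for k
  proof (rule infsumI, rule norm_summable_imp_has_sum)
    have coeff: "summable (\<lambda>n. norm (coeff n k t))"
      using norm_coeff_le[OF assms]
      by (intro summable_comparison_test'[OF summable_mult[OF summable_geometric, of "1/2" "2 * A"], of 0]) auto
    show "summable (\<lambda>n. norm (f n k))"
      using summable_mult[OF coeff, of "\<bar>\<omega> k\<bar>"] by (simp add: f_def norm_mult)
    show "(\<lambda>n. f n k) sums (\<i> * \<omega> k * fourier_coeff (u t) k * cis (of_int k * x))"
      unfolding f_def fourier_coeff_u[OF assms] mode_def
      by (intro sums_mult2 sums_mult summable_sums summable_norm_cancel[OF coeff])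
  qed
  then have "fourier_multiplier (\<lambda>k. \<i> * of_real (\<omega> k)) (u t) x = (\<Sum>\<^sub>\<infinity>n. dispersive_part n t x)"
    unfolding fourier_multiplier_def using swap dispersive_part by simp
  also have "\<dots> = (\<Sum>n. dispersive_part n t x)"
  proof (rule infsumI, rule norm_summable_imp_has_sum)
    show "summable (\<lambda>n. norm (dispersive_part n t x))"
      using norm_dispersive_part_le[OF assms] by (intro summable_comparison_test'[OF summable_geometric_bound, of 0]) simp
    show "(\<lambda>n. dispersive_part n t x) sums (\<Sum>n. dispersive_part n t x)"
      using summable_dispersive_part[OF assms] by (rule summable_sums)
  qed
  finally show ?thesis .
qed

section \<open>Decay of the modes and continuity in Sobolev norms\<close>

definition mode_deriv :: "int \<Rightarrow> real \<Rightarrow> complex" where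
  "mode_deriv k t = (\<Sum>n. coeff_deriv n k t)"

lemma bracket_power_le:
  assumes "k \<noteq> (0::int)"
  shows "(1 + (real_of_int k)\<^sup>2) ^ q \<le> 2 ^ q * \<bar>of_int k\<bar> ^ (2 * q)"
proof -
  have "1 \<le> \<bar>real_of_int k\<bar>" using assms by linarith
  then have "1 \<le> (real_of_int k)\<^sup>2" by (simp add: abs_le_square_iff[of 1, simplified])
  then have "(1 + (real_of_int k)\<^sup>2) ^ q \<le> (2 * (real_of_int k)\<^sup>2) ^ q"
    by (intro power_mono) auto
  then show ?thesis by (simp add: power_mult_distrib power_mult)
qed

text \<open>Comparing \<open>1 + k ^ 2\<close> with \<open>2 * k ^ 2\<close> needs
  \<open>k \<noteq> 0\<close>; the remaining mode 0 vanishes.\<close>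

lemma bracket_coeff_le:
  assumes "\<bar>t\<bar> \<le> T"
  shows "(1 + (of_int k)\<^sup>2) ^ q * norm (coeff n k t)
    \<le> geometric_bound (2 ^ q * (real M ^ (2 * q) * (2 * A))) (2 * q) n"
proof (cases "k \<in> band n \<and> k \<noteq> 0")
  case True
  have "(1 + (of_int k)\<^sup>2) ^ q * norm (coeff n k t) \<le> 2 ^ q * (\<bar>of_int k\<bar> ^ (2 * q) * norm (coeff n k t))"
    using mult_right_mono[OF bracket_power_le norm_ge_zero, of k q "coeff n k t"] True by (simp add: mult_ac)
  also have "\<dots> \<le> 2 ^ q * geometric_bound (real M ^ (2 * q) * (2 * A)) (2 * q) n"
    using True by (intro mult_left_mono norm_weighted_coeff_le assms) auto
  finally show ?thesis by (simp add: geometric_bound_def)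
next
  case False
  then show ?thesis using A_pos by (auto simp: coeff_support geometric_bound_def)
qed

lemma bracket_coeff_deriv_le:
  assumes "\<bar>t\<bar> \<le> T"
  shows "(1 + (of_int k)\<^sup>2) ^ q * norm (coeff_deriv n k t)
    \<le> geometric_bound (2 ^ q * (real M ^ (2 * q) * deriv_const)) (2 * q + 3) n"
proof (cases "k \<in> band n \<and> k \<noteq> 0")
  case True
  have "(1 + (of_int k)\<^sup>2) ^ q * norm (coeff_deriv n k t) \<le> 2 ^ q * (\<bar>of_int k\<bar> ^ (2 * q) * norm (coeff_deriv n k t))"
    using mult_right_mono[OF bracket_power_le norm_ge_zero, of k q "coeff_deriv n k t"] True by (simp add: mult_ac)
  also have "\<dots> \<le> 2 ^ q * geometric_bound (real M ^ (2 * q) * deriv_const) (2 * q + 3) n"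
    using True by (intro mult_left_mono norm_weighted_coeff_deriv_le assms) auto
  finally show ?thesis by (simp add: geometric_bound_def)
next
  case False
  have "coeff_deriv n 0 t = 0" by (cases n) simp_all
  moreover have "0 \<le> deriv_const" using A_pos by (simp add: deriv_const_def)
  ultimately show ?thesis using False by (auto simp: coeff_deriv_support geometric_bound_def)
qed

text \<open>Free of \<open>k\<close> and \<open>t\<close>, so one constant for each order
  \<open>q\<close> serves all modes and the whole time interval.\<close>

definition decay_const :: "nat \<Rightarrow> real" where
  "decay_const q = (\<Sum>n. geometric_bound (2 ^ q * (real M ^ (2 * q) * (2 * A))) (2 * q) n)"

definition decay_deriv_const :: "nat \<Rightarrow> real" where
  "decay_deriv_const q = (\<Sum>n. geometric_bound (2 ^ q * (real M ^ (2 * q) * deriv_const)) (2 * q + 3) n)"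

lemma bracket_mode_le:
  assumes "\<bar>t\<bar> \<le> T"
  shows "(1 + (of_int k)\<^sup>2) ^ q * norm (mode k t) \<le> decay_const q"
  unfolding mode_def decay_const_def
  by (intro weighted_suminf_le bracket_coeff_le[OF assms] summable_geometric_bound one_le_power) simp

lemma bracket_mode_deriv_le:
  assumes "\<bar>t\<bar> \<le> T"
  shows "(1 + (of_int k)\<^sup>2) ^ q * norm (mode_deriv k t) \<le> decay_deriv_const q"
  unfolding mode_deriv_def decay_deriv_const_def
  by (intro weighted_suminf_le bracket_coeff_deriv_le[OF assms] summable_geometric_bound one_le_power) simp

lemma mode_has_vector_derivative:
  assumes "\<bar>t\<bar> < T"
  shows "(mode k has_vector_derivative mode_deriv k t) (at t)"
  unfolding mode_def[abs_def] mode_deriv_def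
proof (rule has_vector_derivative_suminf[where S = "{-T<..<T}"])
  show "norm (coeff_deriv n k \<tau>) \<le> geometric_bound deriv_const 3 n" if "\<tau> \<in> {-T<..<T}" for n \<tau>
    using that bracket_coeff_deriv_le[of \<tau> k 0 n] by auto
  show "summable (\<lambda>n. coeff n k \<tau>)" if "\<tau> \<in> {-T<..<T}" for \<tau>
  proof -
    have "norm (coeff n k \<tau>) \<le> geometric_bound (2 * A) 0 n" for n
      using that bracket_coeff_le[of \<tau> k 0 n] by auto
    then show ?thesis by (rule summable_comparison_test'[OF summable_geometric_bound])
  qed
qed (use assms coeff_has_vector_derivative summable_geometric_bound in auto)

text \<open>The mean value inequality for each mode, with the derivative bound divided by the
  weight; it makes the solution Lipschitz in time in every Sobolev norm.\<close>

lemma bracket_mode_diff_le: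
  assumes "\<bar>t\<bar> < T" "\<bar>\<tau>\<bar> < T"
  shows "(1 + (of_int k)\<^sup>2) ^ q * norm (mode k \<tau> - mode k t) \<le> decay_deriv_const q * \<bar>\<tau> - t\<bar>"
proof -
  define w where "w = (1 + (real_of_int k)\<^sup>2) ^ q"
  have w: "0 < w" by (auto simp: w_def intro!: zero_less_power add_pos_nonneg)
  have "norm (mode k \<tau> - mode k t) \<le> decay_deriv_const q / w * \<bar>\<tau> - t\<bar>"
  proof (rule norm_diff_le_of_vector_derivative[where S = "{-T<..<T}" and f' = "mode_deriv k"])
    show "norm (mode_deriv k z) \<le> decay_deriv_const q / w" if "z \<in> {-T<..<T}" for z
      using that bracket_mode_deriv_le[of z k q] w by (auto simp: w_def[symmetric] field_simps)
  qed (use assms in \<open>auto intro!: mode_has_vector_derivative\<close>)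
  then show ?thesis using w by (simp add: w_def[symmetric] field_simps)
qed

lemma fourier_coeff_u_diff:
  assumes "\<bar>t\<bar> \<le> T" "\<bar>\<tau>\<bar> \<le> T"
  shows "fourier_coeff (\<lambda>x. u \<tau> x - u t x) k = mode k \<tau> - mode k t"
proof -
  have i: "(\<lambda>x. complex_of_real (u \<tau> x) * cis (- (of_int k * x))) integrable_on {-pi..pi}"
    if "\<bar>\<tau>\<bar> \<le> T" for \<tau>
    using that by (intro integrable_continuous_real continuous_intros continuous_u)
  have "fourier_coeff (\<lambda>x. u \<tau> x - u t x) k = fourier_coeff (u \<tau>) k - fourier_coeff (u t) k"
    unfolding fourier_coeff_def
    by (simp add: left_diff_distrib integral_diff i assms diff_divide_distrib)
  then show ?thesis by (simp add: fourier_coeff_u assms)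
qed

lemma u_absolutely_integrable: "\<bar>t\<bar> \<le> T \<Longrightarrow> u t absolutely_integrable_on {-pi..pi}"
  by (intro absolutely_integrable_continuous_real continuous_u)

lemma u_in_sobolev:
  assumes "\<bar>t\<bar> \<le> T"
  shows "u t \<in> sobolev r"
proof -
  have decay: "(1 + (of_int k)\<^sup>2) ^ (nat \<lceil>r\<rceil> + 1) * cmod (fourier_coeff (u t) k) \<le> decay_const (nat \<lceil>r\<rceil> + 1)" for k
    using bracket_mode_le[OF assms] by (simp only: fourier_coeff_u[OF assms])
  have "r \<le> real (nat \<lceil>r\<rceil> + 1)" by linarith
  from sobolev_summable[OF decay this] show ?thesis
    unfolding sobolev_def using u_absolutely_integrable[OF assms] periodic_u by simp
qed

lemma u_continuous_in_sobolev: "continuous_in_sobolev r {-T<..<T} u"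
  unfolding continuous_in_sobolev_def
proof (intro ballI conjI)
  fix t assume t: "t \<in> {-T<..<T}"
  show "u t \<in> sobolev r" using t by (intro u_in_sobolev) auto
  \<comment> \<open>An integer order that is both at least \<open>r\<close> and at least 1, also for
    negative \<open>r\<close>.\<close>
  define q where "q = nat \<lceil>r\<rceil> + 1"
  define S where "S = sqrt (\<Sum>\<^sub>\<infinity>k::int. inverse (1 + (real_of_int k)\<^sup>2))"
  have bound: "norm (sobolev_norm r (\<lambda>x. u \<tau> x - u t x)) \<le> decay_deriv_const q * \<bar>\<tau> - t\<bar> * S" if "\<tau> \<in> {-T<..<T}" for \<tau>
  proof -
    have "sobolev_norm r (\<lambda>x. u \<tau> x - u t x) \<le> decay_deriv_const q * \<bar>\<tau> - t\<bar> * S"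
      unfolding S_def
    proof (rule sobolev_norm_le)
      show "(1 + (of_int k)\<^sup>2) ^ q * cmod (fourier_coeff (\<lambda>x. u \<tau> x - u t x) k) \<le> decay_deriv_const q * \<bar>\<tau> - t\<bar>" for k
      proof -
        have "\<bar>t\<bar> < T" "\<bar>\<tau>\<bar> < T" using t that by auto
        then show ?thesis
          using bracket_mode_diff_le[of t \<tau> k q] by (simp only: fourier_coeff_u_diff less_imp_le)
      qed
      show "r \<le> real q" "1 \<le> q" unfolding q_def by linarith+
    qed
    moreover have "0 \<le> sobolev_norm r (\<lambda>x. u \<tau> x - u t x)"
      unfolding sobolev_norm_def by (intro real_sqrt_ge_zero infsum_nonneg) auto
    ultimately show ?thesis by simp
  qed
  have "((\<lambda>\<tau>. decay_deriv_const q * \<bar>\<tau> - t\<bar> * S) \<longlongrightarrow> decay_deriv_const q * \<bar>t - t\<bar> * S) (at t within {-T<..<T})"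
    by (intro tendsto_intros)
  moreover have "\<forall>\<^sub>F \<tau> in at t within {-T<..<T}.
      norm (sobolev_norm r (\<lambda>x. u \<tau> x - u t x)) \<le> decay_deriv_const q * \<bar>\<tau> - t\<bar> * S"
    unfolding eventually_at_filter by (intro always_eventually allI impI) (rule bound)
  ultimately show "((\<lambda>\<tau>. sobolev_norm r (\<lambda>x. u \<tau> x - u t x)) \<longlongrightarrow> 0) (at t within {-T<..<T})"
    by (intro Lim_null_comparison[of "\<lambda>\<tau>. sobolev_norm r (\<lambda>x. u \<tau> x - u t x)"]) simp_all
qed

lemma u_solution:
  assumes "\<And>k. disp_symbol \<alpha> k = \<i> * of_real (\<omega> k)"
  shows "solution_on \<alpha> (u 0) T u"
proof -
  have symbol: "disp_symbol \<alpha> = (\<lambda>k. \<i> * of_real (\<omega> k))"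
    by (intro ext assms)
  have t: "\<bar>t\<bar> < T" "\<bar>t\<bar> \<le> T" if "t \<in> {-T<..<T}" for t
    using that by auto
  show ?thesis
    unfolding solution_on_def symbol
  proof (intro conjI ballI allI impI)
    fix t x assume "t \<in> {-T<..<T}"
    note t = t[OF this]
    show "u t \<in> smooth_torus" by (rule smooth_u[OF t(2)])
    show "(\<lambda>\<tau>. u \<tau> x) differentiable at t" by (rule u_solves(1)[OF t(1)])
    show "complex_of_real (deriv (\<lambda>\<tau>. u \<tau> x) t)
        + fourier_multiplier (\<lambda>k. \<i> * of_real (\<omega> k)) (u t) x
        + complex_of_real (u t x * deriv (u t) x) = 0"
      unfolding fourier_multiplier_u[OF t(2)] by (rule u_solves(2)[OF t(1)])
  qed (rule T_pos refl u_continuous_in_sobolev)+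
qed

text \<open>For \<open>s \<le> 0\<close> and nonzero integers \<open>k\<close> the weight is at most
  1, so square summability suffices; the mean vanishes because every \<open>coeff n 0\<close>
  does.\<close>

lemma u_in_hom_sobolev:
  assumes "\<bar>t\<bar> \<le> T" "s \<le> 0"
  shows "u t \<in> hom_sobolev s"
proof -
  have "(\<lambda>k. (1 + (of_int k)\<^sup>2) powr 0 * (cmod (fourier_coeff (u t) k))\<^sup>2) summable_on UNIV"
    using u_in_sobolev[OF assms(1), of 0] by (simp add: sobolev_def)
  then have "(\<lambda>k. (1 + (of_int k)\<^sup>2) powr 0 * (cmod (fourier_coeff (u t) k))\<^sup>2) summable_on UNIV - {0}"
    by (rule summable_on_subset_banach) auto
  moreover have "\<bar>of_int k\<bar> powr (2 * s) * (cmod (fourier_coeff (u t) k))\<^sup>2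
      \<le> (1 + (of_int k)\<^sup>2) powr 0 * (cmod (fourier_coeff (u t) k))\<^sup>2" if "k \<in> UNIV - {0}" for k
  proof (rule mult_right_mono)
    have "1 \<le> \<bar>real_of_int k\<bar>" using that by auto
    then have "\<bar>real_of_int k\<bar> powr (2 * s) \<le> \<bar>real_of_int k\<bar> powr 0"
      using assms(2) by (intro powr_mono) auto
    moreover have "0 < 1 + (real_of_int k)\<^sup>2" by (intro add_pos_nonneg) auto
    ultimately show "\<bar>real_of_int k\<bar> powr (2 * s) \<le> (1 + (real_of_int k)\<^sup>2) powr 0"
      using that by simp
  qed simp
  ultimately have "(\<lambda>k. \<bar>of_int k\<bar> powr (2 * s) * (cmod (fourier_coeff (u t) k))\<^sup>2) summable_on UNIV - {0}"
    by (rule summable_on_comparison_test) auto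
  moreover have "fourier_coeff (u t) 0 = 0"
    by (simp add: fourier_coeff_u[OF assms(1)] mode_def)
  ultimately show ?thesis
    unfolding hom_sobolev_def
    using u_absolutely_integrable[OF assms(1)] periodic_u by simp
qed

lemma mode_initial: "mode k 0 = a k"
  unfolding mode_def coeff_initial using suminf_finite[of "{0}" "\<lambda>n. if n = 0 then a k else 0"] by simp

end

section \<open>Norm inflation\<close>

text \<open>\<open>3 \<le> N\<close> keeps the mode 1 outside the support of the datum, so that all
  of it at later times comes from interactions.\<close>

locale two_modes =
  fixes \<alpha> :: real and N :: nat
  assumes \<alpha>: "\<alpha> < 2" and N: "3 \<le> N"
begin

definition M :: nat where "M = Suc N"

lemma int_M: "int M = 1 + int N"
  by (simp add: M_def)

definition dispersion :: "int \<Rightarrow> real" where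
  "dispersion k = \<bar>of_int k\<bar> powr \<alpha> * of_int k"

definition modes :: "int set" where
  "modes = {int M, - int M, int N, - int N}"

definition data :: "int \<Rightarrow> complex" where
  "data k = (if k \<in> modes then of_real (real M ^ 2) else 0)"

text \<open>This is where \<open>\<alpha> < 2\<close> enters: nonzero frequencies have modulus at
  least 1, so the exponent may be raised to 2.\<close>

lemma dispersion_le: "\<bar>dispersion k\<bar> \<le> \<bar>of_int k\<bar> ^ 3"
proof (cases "k = 0")
  case False
  then have k: "1 \<le> \<bar>real_of_int k\<bar>" by linarith
  then have "\<bar>real_of_int k\<bar> powr \<alpha> \<le> \<bar>real_of_int k\<bar> powr 2"
    using \<alpha> by (intro powr_mono) auto
  then have "\<bar>real_of_int k\<bar> powr \<alpha> \<le> \<bar>real_of_int k\<bar> ^ 2"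
    using k by (simp add: powr_numeral)
  then show ?thesis
    using mult_right_mono[of _ _ "\<bar>real_of_int k\<bar>"]
    by (simp add: dispersion_def abs_mult power3_eq_cube power2_eq_square)
qed (simp add: dispersion_def)

sublocale fourier_hierarchy dispersion data M
proof
  show "data (- k) = cnj (data k)" for k
    by (auto simp: data_def modes_def)
  show "\<exists>k. data k \<noteq> 0"
    by (intro exI[of _ "int M"]) (simp add: data_def modes_def, simp add: M_def del: of_nat_Suc)
  show "data k = 0" if "int M < \<bar>k\<bar>" for k
    using that by (auto simp: data_def modes_def M_def)
  show "\<bar>dispersion k\<bar> \<le> \<bar>of_int k\<bar> ^ 3" for k
    by (rule dispersion_le)
qed (use N in \<open>auto simp: M_def dispersion_def data_def modes_def\<close>)

lemma M_ge: "4 \<le> M"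
  using N by (simp add: M_def)

lemma finite_modes: "finite modes"
  by (simp add: modes_def)

lemma card_modes: "card modes = 4"
  using N by (simp add: modes_def M_def card_insert_if)

lemma A_eq: "A = 4 * real M ^ 2"
proof -
  have "A = (\<Sum>k\<in>modes. norm (data k))"
    unfolding A_def by (rule sum.mono_neutral_right) (auto simp: band_def modes_def int_M data_def)
  also have "\<dots> = (\<Sum>k\<in>modes. real M ^ 2)"
    by (rule sum.cong) (auto simp: data_def norm_power)
  finally show ?thesis by (simp add: card_modes)
qed

section \<open>Growth of the mode 1 at the inflation time\<close>

text \<open>With \<open>d = 4 * M * A * time\<close> the quadratic part at the mode 1 is at least
  \<open>M * d / 32\<close>, and the rest is about \<open>4 * M * d ^ 2\<close>. The constant 8192
  gives \<open>d = 1 / 512\<close>, for which the rest is less than half of the quadratic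
  part.\<close>

definition time :: real where
  "time = 1 / (8192 * real M ^ 3)"

lemma time_pos: "0 < time"
  using M_ge by (simp add: time_def)

lemma T_eq: "T = 256 * time"
  by (simp add: T_def time_def A_eq power3_eq_cube power2_eq_square)

text \<open>The only ordered pairs of active frequencies with sum 1 are \<open>(M, -N)\<close> and
  \<open>(-N, M)\<close>, which gives the factor 2.\<close>

lemma conv_0_1: "conv 0 1 \<tau> =
  of_real (2 * real M ^ 4) * cis ((dispersion (int N) - dispersion (int M)) * \<tau>)"
proof -
  have "conv 0 1 \<tau> = (\<Sum>j\<in>band 0. coeff 0 j \<tau> * coeff 0 (1 - j) \<tau>)"
    by (simp add: conv_def)
  also have "\<dots> = (\<Sum>j\<in>{int M, - int N}. coeff 0 j \<tau> * coeff 0 (1 - j) \<tau>)"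
    by (rule sum.mono_neutral_right)
      (use N in \<open>auto simp: band_def int_M coeff.simps(1) data_def modes_def\<close>)
  also have "\<dots> = 2 * (coeff 0 (int M) \<tau> * coeff 0 (- int N) \<tau>)"
    by (simp add: int_M)
  also have "coeff 0 (int M) \<tau> * coeff 0 (- int N) \<tau>
      = of_real (real M ^ 4) * cis ((dispersion (int N) - dispersion (int M)) * \<tau>)"
    by (simp add: coeff.simps(1) data_def modes_def \<omega>_odd cis_mult algebra_simps
        flip: power_add of_real_mult)
  finally show ?thesis by simp
qed

text \<open>On the time scale \<open>1 / M\<^sup>3\<close> all phases stay small because \<open>\<alpha> + 1 < 3\<close>, so that the
  quadratic interaction of the two modes grows linearly in time.\<close>

lemma norm_coeff_1_1_ge: "real M / 16384 \<le> norm (coeff (Suc 0) 1 time)"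
proof -
  define b where "b = dispersion 1 + (dispersion (int N) - dispersion (int M))"
  have "(\<lambda>\<tau>. cis (dispersion 1 * \<tau>) * conv 0 1 \<tau>) = (\<lambda>\<tau>. of_real (2 * real M ^ 4) * cis (b * \<tau>))"
    by (simp add: conv_0_1 b_def distrib_right mult.left_commute[of "cis _"] cis_mult)
  then have norm_coeff: "norm (coeff (Suc 0) 1 time)
      = norm (primitive (\<lambda>\<tau>. of_real (2 * real M ^ 4) * cis (b * \<tau>)) time) / 2"
    by (simp add: coeff_Suc norm_mult norm_divide)
  have "\<bar>dispersion 1\<bar> \<le> real M ^ 3" "\<bar>dispersion (int N)\<bar> \<le> real M ^ 3" "\<bar>dispersion (int M)\<bar> \<le> real M ^ 3"
    using order_trans[OF dispersion_le[of 1], of "real M ^ 3"] M_ge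
      order_trans[OF dispersion_le[of "int N"], of "real M ^ 3"] dispersion_le[of "int M"]
    by (auto simp: M_def intro: power_mono)
  then have "\<bar>b\<bar> \<le> 3 * real M ^ 3"
    unfolding b_def by linarith
  then have "\<bar>b\<bar> * time \<le> 3 * real M ^ 3 * time"
    using time_pos by (intro mult_right_mono) auto
  also have "\<dots> \<le> 1"
    using M_ge by (simp add: time_def)
  finally have "2 * real M ^ 4 * time / 2 \<le> norm (primitive (\<lambda>\<tau>. of_real (2 * real M ^ 4) * cis (b * \<tau>)) time)"
    using time_pos by (intro norm_primitive_cis_ge) auto
  moreover have "real M ^ 4 * time = real M / 8192"
    using M_ge by (simp add: time_def power3_eq_cube power4_eq_xxxx)
  ultimately show ?thesis unfolding norm_coeff by linarith
qed

text \<open>\<open>norm_coeff_Suc_le\<close> at \<open>k = 1\<close> leaves the prefactor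
  \<open>A / M = 4 * M\<close> where the plain majorant would give \<open>2 * A\<close>, of order
  \<open>M ^ 2\<close>.\<close>

lemma norm_coeff_1_le: "norm (coeff (Suc n) 1 time) \<le> 4 * real M * (1 / 512) ^ Suc n"
proof -
  have "norm (coeff (Suc n) 1 time) \<le> 1 / 2 * (majorant (Suc n) / real M * time ^ Suc n)"
    using norm_coeff_Suc_le[of n 1 time] time_pos by simp
  also have "\<dots> \<le> 1 / 2 * ((2 * A * (4 * M * A) ^ Suc n) / real M * time ^ Suc n)"
    using time_pos by (intro mult_left_mono mult_right_mono divide_right_mono majorant_le) auto
  also have "\<dots> = A / real M * (4 * M * A * time) ^ Suc n"
    by (simp add: power_mult_distrib)
  also have "4 * M * A * time = 1 / 512"
    using M_ge by (simp add: A_eq time_def power3_eq_cube power2_eq_square)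
  also have "A / real M = 4 * real M"
    using M_ge by (simp add: A_eq power2_eq_square)
  finally show ?thesis .
qed

text \<open>Degree one is absent at this mode, degree two contributes at least
  \<open>M / 16384\<close>, and the geometric tail from degree three on is at most
  \<open>M / 32768\<close>.\<close>

lemma norm_mode_1_ge: "real M / 32768 \<le> norm (mode 1 time)"
proof -
  have time: "\<bar>time\<bar> \<le> T" using time_pos by (simp add: T_eq)
  have summable: "summable (\<lambda>n. coeff n 1 time)"
  proof (rule summable_comparison_test'[OF summable_mult[OF summable_geometric]])
    show "norm (coeff n 1 time) \<le> 2 * A * (1 / 2) ^ n" for n
      by (rule norm_coeff_le[OF time])
  qed simp
  have coeff_0: "coeff 0 1 time = 0"
    using N by (simp add: coeff.simps(1) data_def modes_def int_M)
  have "(\<Sum>n. coeff (n + 2) 1 time) = mode 1 time - (\<Sum>n<2. coeff n 1 time)"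
    unfolding mode_def by (rule suminf_minus_initial_segment[OF summable])
  then have split: "coeff (Suc 0) 1 time = mode 1 time - (\<Sum>n. coeff (n + 2) 1 time)"
    by (simp add: numeral_2_eq_2 coeff_0)
  have tail: "norm (\<Sum>n. coeff (n + 2) 1 time) \<le> (\<Sum>n. 4 * real M * (1 / 512) ^ 2 * (1 / 512) ^ n)"
  proof (rule norm_suminf_le)
    show "norm (coeff (n + 2) 1 time) \<le> 4 * real M * (1 / 512) ^ 2 * (1 / 512) ^ n" for n
      using norm_coeff_1_le[of "Suc n"] by (simp add: power2_eq_square)
  qed (intro summable_mult summable_geometric, simp)
  also have "\<dots> = 4 * real M * (1 / 512) ^ 2 * (1 / (1 - 1 / 512))"
    by (subst suminf_mult) (simp_all add: suminf_geometric summable_geometric)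
  also have "\<dots> \<le> real M / 32768"
    by (simp add: power2_eq_square)
  finally have "norm (\<Sum>n. coeff (n + 2) 1 time) \<le> real M / 32768" .
  then show ?thesis
    using norm_coeff_1_1_ge norm_triangle_ineq4[of "mode 1 time" "\<Sum>n. coeff (n + 2) 1 time"]
    unfolding split by linarith
qed

text \<open>All four active frequencies have modulus at least \<open>N\<close>, and for
  \<open>s \<le> 0\<close> the weight decreases in the frequency; the 2 is the square root of the
  number of modes.\<close>

lemma hom_sobolev_norm_initial_le:
  assumes "s \<le> 0"
  shows "hom_sobolev_norm s (u 0) \<le> 2 * real M ^ 2 * real N powr s"
proof -
  have coeff: "fourier_coeff (u 0) k = data k" for k
    using fourier_coeff_u[of 0 k] T_pos by (simp add: mode_initial)
  have "(\<Sum>\<^sub>\<infinity>k\<in>UNIV - {0}. \<bar>of_int k\<bar> powr (2 * s) * (cmod (fourier_coeff (u 0) k))\<^sup>2)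
      = (\<Sum>\<^sub>\<infinity>k\<in>modes. \<bar>of_int k\<bar> powr (2 * s) * (cmod (fourier_coeff (u 0) k))\<^sup>2)"
    by (rule infsum_cong_neutral) (use N in \<open>auto simp: coeff data_def modes_def int_M\<close>)
  also have "\<dots> = (\<Sum>k\<in>modes. \<bar>of_int k\<bar> powr (2 * s) * (cmod (fourier_coeff (u 0) k))\<^sup>2)"
    by (simp add: finite_modes)
  also have "\<dots> \<le> (\<Sum>k\<in>modes. real N powr (2 * s) * (real M ^ 2)\<^sup>2)"
  proof (rule sum_mono)
    fix k assume k: "k \<in> modes"
    then have "real N \<le> \<bar>of_int k\<bar>" by (auto simp: modes_def M_def)
    then have "\<bar>of_int k\<bar> powr (2 * s) \<le> real N powr (2 * s)"
      using assms N by (intro powr_mono2') auto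
    then show "\<bar>of_int k\<bar> powr (2 * s) * (cmod (fourier_coeff (u 0) k))\<^sup>2
        \<le> real N powr (2 * s) * (real M ^ 2)\<^sup>2"
      using k by (intro mult_mono) (auto simp: coeff data_def norm_power)
  qed
  also have "\<dots> = (2 * real M ^ 2 * real N powr s)\<^sup>2"
    by (simp add: card_modes power_mult_distrib powr_add[symmetric] power2_eq_square[of "real N powr s"])
  finally have "hom_sobolev_norm s (u 0) \<le> sqrt ((2 * real M ^ 2 * real N powr s)\<^sup>2)"
    unfolding hom_sobolev_norm_def by (rule real_sqrt_le_mono)
  then show ?thesis by simp
qed

end

theorem theorem1p2:
  fixes \<alpha> s \<epsilon> :: real
  assumes "-1 \<le> \<alpha>" and "\<alpha> < 2" and "s < -2" and "\<epsilon> > 0"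
  shows "\<exists>(u\<^sub>0 :: real \<Rightarrow> real) (t :: real) (T :: real) (u :: real \<Rightarrow> real \<Rightarrow> real).
           u\<^sub>0 \<in> smooth_torus \<and> u\<^sub>0 \<in> hom_sobolev s \<and>
           0 < t \<and> t < \<epsilon> \<and> t < T \<and> solution_on \<alpha> u\<^sub>0 T u \<and> u t \<in> hom_sobolev s \<and>
           hom_sobolev_norm s u\<^sub>0 < \<epsilon> \<and> hom_sobolev_norm s (u t) > inverse \<epsilon>"
proof -
  \<comment> \<open>The bound on the datum becomes
    \<open>2 * (2 * N) ^ 2 * N powr s = 8 * N powr (s + 2)\<close> by \<open>M \<le> 2 * N\<close>,
    and it tends to 0 because \<open>s < -2\<close>. The second condition on \<open>N\<close> makes
    \<open>M / 32768\<close> exceed \<open>inverse \<epsilon>\<close> and also forces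
    \<open>time < \<epsilon>\<close>.\<close>
  have "((\<lambda>N. 8 * real N powr (s + 2)) \<longlongrightarrow> 8 * 0) sequentially"
    using assms(3) by (intro tendsto_intros tendsto_neg_powr filterlim_real_sequentially) auto
  then have "\<forall>\<^sub>F N in sequentially. 8 * real N powr (s + 2) < \<epsilon>"
    using assms(4) by (intro order_tendstoD) auto
  moreover have "\<forall>\<^sub>F N in sequentially. 32768 / \<epsilon> \<le> real N"
    using filterlim_real_sequentially by (simp add: filterlim_at_top)
  ultimately have "\<forall>\<^sub>F N in sequentially. 8 * real N powr (s + 2) < \<epsilon> \<and> 32768 / \<epsilon> \<le> real N \<and> 3 \<le> N"
    using eventually_ge_at_top[of 3] by eventually_elim simp
  then obtain N where small: "8 * real N powr (s + 2) < \<epsilon>" and large: "32768 / \<epsilon> \<le> real N" and N: "3 \<le> N"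
    by (metis (mono_tags, lifting) eventually_sequentially order_refl)
  interpret two_modes \<alpha> N
    using assms(2) N by unfold_locales
  have M: "32768 / \<epsilon> < real M" "real M \<le> 2 * real N"
    using large N by (simp_all add: M_def)
  have t: "0 < time" "time < T" "\<bar>time\<bar> \<le> T" "\<bar>0\<bar> \<le> T"
    using time_pos by (simp_all add: T_eq)
  show ?thesis
  proof (intro exI conjI)
    show "u 0 \<in> smooth_torus" "u 0 \<in> hom_sobolev s" "u time \<in> hom_sobolev s"
      using t assms(3) by (auto intro: smooth_u u_in_hom_sobolev)
    show "0 < time" "time < T" using t by auto
    show "solution_on \<alpha> (u 0) T u"
      by (rule u_solution) (simp add: disp_symbol_def dispersion_def)
    show "time < \<epsilon>"
    proof -
      have "1 \<le> real M ^ 2"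
        using M_ge by (intro one_le_power) simp
      then have "real M * 1 \<le> real M * (8192 * real M ^ 2)"
        by (intro mult_left_mono) linarith+
      then have "time \<le> 1 / real M"
        using M_ge unfolding time_def by (intro divide_left_mono) (auto simp: power2_eq_square power3_eq_cube)
      also have "\<dots> < \<epsilon>"
        using M(1) assms(4) M_ge by (simp add: field_simps)
      finally show ?thesis .
    qed
    show "hom_sobolev_norm s (u 0) < \<epsilon>"
    proof -
      have "hom_sobolev_norm s (u 0) \<le> 2 * real M ^ 2 * real N powr s"
        using assms(3) by (intro hom_sobolev_norm_initial_le) simp
      also have "\<dots> \<le> 2 * (2 * real N) ^ 2 * real N powr s"
        using M(2) by (intro mult_right_mono mult_left_mono power_mono) auto
      also have "\<dots> = 8 * real N powr (s + 2)"
        using N by (simp add: powr_add powr_numeral power_mult_distrib)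
      finally show ?thesis using small by simp
    qed
    have "inverse \<epsilon> < real M / 32768"
      using M(1) by (simp add: field_simps)
    also have "\<dots> \<le> norm (fourier_coeff (u time) 1)"
      using norm_mode_1_ge fourier_coeff_u[OF t(3)] by simp
    also have "\<dots> \<le> hom_sobolev_norm s (u time)"
      using t assms(3) by (intro norm_fourier_coeff_1_le u_in_hom_sobolev) auto
    finally show "inverse \<epsilon> < hom_sobolev_norm s (u time)" .
  qed
qed

end
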